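(* Let each $f_i:\mathbb{R}^p\to\mathbb{R}$ ($i=1,\dots,n$) be $\mu_i$-strongly convex and $L_i$-smooth, and let the stochastic gradients satisfy the stochastic gradient assumption with constant $\sigma>0$. Let $\bar{x}_k=\frac1n\sum_{i=1}^nx_{i,k}$ be the average iterates produced by the stochastic NEAR-DGD$^+$ method with steplength $\alpha\le\min_i\big(\frac{2}{\mu_i+L_i}\big)$. Then $\bar{x}_k$ converges to a neighborhood of the optimal solution $x^\star=\arg\min_{x\in\mathbb{R}^p}\sum_{i=1}^nf_i(x)$ with size $$\mathcal{O}\Big(\frac{\alpha^2\sigma^2}{n(1-c_1)}\Big),$$ where $c_1=(1+\psi)(1-2\alpha\gamma_{\bar f})$, $\psi<2\alpha\gamma_{\bar f}/(1-2\alpha\gamma_{\bar f})$ is a positive constant, $\gamma_{\bar f}=\frac{\mu_{\bar f}L_{\bar f}}{\mu_{\bar f}+L_{\bar f}}$, $\mu_{\bar f}=\frac1n\sum_{i=1}^n\mu_i$ and $L_{\bar f}=\frac1n\sum_{i=1}^nL_i$.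
   Context: Setting: $n$ agents in a connected network; agent $i$ holds $f_i$. $L_i$-smooth means the gradient is $L_i$-Lipschitz. Convergence to a neighborhood of a given size is meant in expectation of the squared distance: it refers to the size of $\limsup_{k\to\infty}\mathbb{E}[\|\bar{x}_k-x^\star\|^2]$. Consensus matrix: $\mathbf{W}\in\mathbb{R}^{n\times n}$ is symmetric and doubly stochastic with strictly positive diagonal entries; its off-diagonal entries $w_{ij}$ are strictly positive if and only if agents $i$ and $j$ are connected, and zero otherwise. $\mathbf{Z}=\mathbf{W}\otimes I_p\in\mathbb{R}^{np\times np}$, where $I_p$ is the identity matrix. Stochastic NEAR-DGD$^+$ (the number of consensus steps increases by one at every iteration, $t(k)=k$), with constant steplength $\alpha>0$: from an initial point $\mathbf{y}_0=[y_{1,0},\dots,y_{n,0}]\in\mathbb{R}^{np}$, for $k=0,1,2,\dots$ $$\mathbf{x}_k=\mathbf{Z}^{k}\mathbf{y}_k,\qquad \mathbf{y}_{k+1}=\mathbf{x}_k-\alpha\,\mathbf{g}(\mathbf{x}_k,\boldsymbol{\xi}_k),$$ where $\mathbf{x}_k=[x_{1,k},\dots,x_{n,k}]$ and $\mathbf{y}_k=[y_{1,k},\dots,y_{n,k}]$ are concatenations of local variables in $\mathbb{R}^p$, and $\mathbf{g}(\mathbf{x}_k,\boldsymbol{\xi}_k)$ is the concatenation of the local stochastic gradients $g_i(x_{i,k},\xi_{i,k})\in\mathbb{R}^p$. Stochastic gradient assumption: $g_i(x_{i,k},\xi_{i,k})$ is the stochastic gradient computed at agent $i$ at iteration $k$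 and $\xi_{i,k}$ is a random vector; for all $i=1,\dots,n$ and $k=0,1,2,\dots$, $$\mathbb{E}[g_i(x_{i,k},\xi_{i,k})\mid x_{i,k}]=\nabla f_i(x_{i,k}),\qquad \mathbb{E}[\|g_i(x_{i,k},\xi_{i,k})-\nabla f_i(x_{i,k})\|^2\mid x_{i,k}]\le\sigma^2.$$
   Formalization: The bound with a constant independent of n is proved assuming the gradient errors of distinct agents are uncorrelated within each iteration (it fails for identical noise at all agents); without this the constant may depend on n. The constant is chosen for fixed p and sample spaces. *)

theory Defs
  imports "HOL-Probability.Probability"
begin

text \<open>
  Agents are the numbers \<open>i < n\<close>. A stacked vector in $\mathbb{R}^{np}$ is a function
  \<open>nat \<Rightarrow> real^'p\<close>, of which only the blocks with index \<open>i < n\<close> are meaningful.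
\<close>

subsection \<open>Objective functions\<close>

definition gradient :: "(real^'p \<Rightarrow> real) \<Rightarrow> real^'p \<Rightarrow> real^'p" where
  "gradient f x = (THE D. GDERIV f x :> D)"

definition smooth_with :: "real \<Rightarrow> (real^'p \<Rightarrow> real) \<Rightarrow> bool" where
  "smooth_with L f \<longleftrightarrow> (\<forall>x. \<exists>D. GDERIV f x :> D) \<and> L-lipschitz_on UNIV (gradient f)"

definition strongly_convex_with :: "real \<Rightarrow> (real^'p \<Rightarrow> real) \<Rightarrow> bool" where
  "strongly_convex_with \<mu> f \<longleftrightarrow> \<mu> > 0 \<and>
     (\<forall>x y. \<forall>t\<in>{0..1}. f (t *\<^sub>R x + (1 - t) *\<^sub>R y) \<le>
        t * f x + (1 - t) * f y - \<mu> / 2 * t * (1 - t) * (norm (x - y))\<^sup>2)"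

definition minimizer :: "nat \<Rightarrow> (nat \<Rightarrow> real^'p \<Rightarrow> real) \<Rightarrow> real^'p" where
  "minimizer n f = (ARG_MIN (\<lambda>x. \<Sum>i<n. f i x) x. True)"

subsection \<open>Network and consensus matrix\<close>

definition connected_network :: "nat \<Rightarrow> (nat \<times> nat) set \<Rightarrow> bool" where
  "connected_network n E \<longleftrightarrow> E \<subseteq> {..<n} \<times> {..<n} \<and> sym E \<and> irrefl E \<and>
     (\<forall>i<n. \<forall>j<n. (i, j) \<in> E\<^sup>*)"

definition consensus_matrix :: "nat \<Rightarrow> (nat \<times> nat) set \<Rightarrow> (nat \<Rightarrow> nat \<Rightarrow> real) \<Rightarrow> bool" where
  "consensus_matrix n E W \<longleftrightarrow>
     (\<forall>i<n. \<forall>j<n. W i j = W j i) \<and>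
     (\<forall>i<n. \<forall>j<n. W i j \<ge> 0) \<and>
     (\<forall>i<n. (\<Sum>j<n. W i j) = 1) \<and>
     (\<forall>j<n. (\<Sum>i<n. W i j) = 1) \<and>
     (\<forall>i<n. W i i > 0) \<and>
     (\<forall>i<n. \<forall>j<n. i \<noteq> j \<longrightarrow> (if (i, j) \<in> E then W i j > 0 else W i j = 0))"

text \<open>The action of $\mathbf{Z} = \mathbf{W} \otimes I_p$ on a stacked vector.\<close>

definition consensus :: "nat \<Rightarrow> (nat \<Rightarrow> nat \<Rightarrow> real) \<Rightarrow> (nat \<Rightarrow> real^'p) \<Rightarrow> (nat \<Rightarrow> real^'p)" where
  "consensus n W y = (\<lambda>i. \<Sum>j<n. W i j *\<^sub>R y j)"

subsection \<open>The stochastic NEAR-DGD+ iteration\<close>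

text \<open>
  The iterates along one realization: \<open>g i x s\<close> is agent \<open>i\<close>'s stochastic gradient
  at \<open>x\<close> for the sample \<open>s\<close>, and \<open>s i k\<close> is the realized sample of agent \<open>i\<close> at iteration \<open>k\<close>.
\<close>

primrec near_dgd_y :: "nat \<Rightarrow> (nat \<Rightarrow> nat \<Rightarrow> real) \<Rightarrow> real \<Rightarrow> (nat \<Rightarrow> real^'p \<Rightarrow> 'd \<Rightarrow> real^'p) \<Rightarrow>
    (nat \<Rightarrow> real^'p) \<Rightarrow> (nat \<Rightarrow> nat \<Rightarrow> 'd) \<Rightarrow> nat \<Rightarrow> (nat \<Rightarrow> real^'p)" where
  "near_dgd_y n W \<alpha> g y0 s 0 = y0"
| "near_dgd_y n W \<alpha> g y0 s (Suc k) =
     (let x = (consensus n W ^^ k) (near_dgd_y n W \<alpha> g y0 s k)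
      in (\<lambda>i. x i - \<alpha> *\<^sub>R g i (x i) (s i k)))"

definition near_dgd_x :: "nat \<Rightarrow> (nat \<Rightarrow> nat \<Rightarrow> real) \<Rightarrow> real \<Rightarrow> (nat \<Rightarrow> real^'p \<Rightarrow> 'd \<Rightarrow> real^'p) \<Rightarrow>
    (nat \<Rightarrow> real^'p) \<Rightarrow> (nat \<Rightarrow> nat \<Rightarrow> 'd) \<Rightarrow> nat \<Rightarrow> (nat \<Rightarrow> real^'p)" where
  "near_dgd_x n W \<alpha> g y0 s k = (consensus n W ^^ k) (near_dgd_y n W \<alpha> g y0 s k)"

definition near_dgd_avg :: "nat \<Rightarrow> (nat \<Rightarrow> nat \<Rightarrow> real) \<Rightarrow> real \<Rightarrow> (nat \<Rightarrow> real^'p \<Rightarrow> 'd \<Rightarrow> real^'p) \<Rightarrow>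
    (nat \<Rightarrow> real^'p) \<Rightarrow> (nat \<Rightarrow> nat \<Rightarrow> 'd) \<Rightarrow> nat \<Rightarrow> real^'p" where
  "near_dgd_avg n W \<alpha> g y0 s k = (1 / real n) *\<^sub>R (\<Sum>i<n. near_dgd_x n W \<alpha> g y0 s k i)"

subsection \<open>Stochastic gradients\<close>

definition generated_algebra :: "'w measure \<Rightarrow> ('w \<Rightarrow> real^'p) \<Rightarrow> 'w measure" where
  "generated_algebra M X = vimage_algebra (space M) X borel"

text \<open>
  The stochastic gradient assumption for one agent at one iteration, where \<open>G\<close> is the random
  vector $g_i(x_{i,k}, \xi_{i,k})$ and \<open>X\<close> is $x_{i,k}$. The library's conditional expectation is
  real-valued, so unbiasedness is stated for each coordinate.
\<close>

definition stochastic_gradient_of ::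
    "'w measure \<Rightarrow> (real^'p \<Rightarrow> real) \<Rightarrow> real \<Rightarrow> ('w \<Rightarrow> real^'p) \<Rightarrow> ('w \<Rightarrow> real^'p) \<Rightarrow> bool" where
  "stochastic_gradient_of M f \<sigma> X G \<longleftrightarrow>
     integrable M G \<and>
     (\<forall>c. AE \<omega> in M. real_cond_exp M (generated_algebra M X) (\<lambda>\<omega>. G \<omega> $ c) \<omega> = gradient f (X \<omega>) $ c) \<and>
     (AE \<omega> in M. nn_cond_exp M (generated_algebra M X)
        (\<lambda>\<omega>. ennreal ((norm (G \<omega> - gradient f (X \<omega>)))\<^sup>2)) \<omega> \<le> ennreal (\<sigma>\<^sup>2))"

locale stochastic_near_dgd = prob_space M
  for M :: "'w measure" +
  fixes n :: nat
    and E :: "(nat \<times> nat) set"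
    and W :: "nat \<Rightarrow> nat \<Rightarrow> real"
    and f :: "nat \<Rightarrow> real^'p \<Rightarrow> real"
    and \<mu> L :: "nat \<Rightarrow> real"
    and g :: "nat \<Rightarrow> real^'p \<Rightarrow> 'd::euclidean_space \<Rightarrow> real^'p"
    and \<xi> :: "nat \<Rightarrow> nat \<Rightarrow> 'w \<Rightarrow> 'd"
    and \<sigma> \<alpha> :: real
    and y0 :: "nat \<Rightarrow> real^'p"
  assumes agents: "n \<ge> 1"
    and network: "connected_network n E"
    and consensus: "consensus_matrix n E W"
    and strongly_convex: "\<And>i. i < n \<Longrightarrow> strongly_convex_with (\<mu> i) (f i)"
    and smooth: "\<And>i. i < n \<Longrightarrow> smooth_with (L i) (f i)"
    and samples: "\<And>i k. i < n \<Longrightarrow> \<xi> i k \<in> borel_measurable M"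
    and noise_level: "\<sigma> > 0"
    and steplength_pos: "\<alpha> > 0"
    and steplength: "\<alpha> \<le> (MIN i\<in>{..<n}. 2 / (\<mu> i + L i))"
    and stochastic_gradients: "\<And>i k. i < n \<Longrightarrow>
      stochastic_gradient_of M (f i) \<sigma>
        (\<lambda>\<omega>. near_dgd_x n W \<alpha> g y0 (\<lambda>i k. \<xi> i k \<omega>) k i)
        (\<lambda>\<omega>. g i (near_dgd_x n W \<alpha> g y0 (\<lambda>i k. \<xi> i k \<omega>) k i) (\<xi> i k \<omega>))"

text \<open>
  Within each iteration, the gradient errors of distinct agents are uncorrelated. This is what
  averaging over agents needs in order to reduce the variance from $\sigma^2$ to $\sigma^2/n$;
  it holds when the samples are drawn independently.
\<close>

definition uncorrelated_errors :: "'w measure \<Rightarrow> nat \<Rightarrow> (nat \<Rightarrow> nat \<Rightarrow> real) \<Rightarrow>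
    (nat \<Rightarrow> real^'p \<Rightarrow> real) \<Rightarrow> (nat \<Rightarrow> real^'p \<Rightarrow> 'd \<Rightarrow> real^'p) \<Rightarrow> (nat \<Rightarrow> nat \<Rightarrow> 'w \<Rightarrow> 'd) \<Rightarrow>
    real \<Rightarrow> (nat \<Rightarrow> real^'p) \<Rightarrow> bool" where
  "uncorrelated_errors M n W f g \<xi> \<alpha> y0 \<longleftrightarrow>
     (let x = (\<lambda>k i \<omega>. near_dgd_x n W \<alpha> g y0 (\<lambda>i k. \<xi> i k \<omega>) k i);
          err = (\<lambda>k i \<omega>. g i (x k i \<omega>) (\<xi> i k \<omega>) - gradient (f i) (x k i \<omega>))
      in \<forall>k. \<forall>i<n. \<forall>j<n. i \<noteq> j \<longrightarrow> (\<integral>\<omega>. err k i \<omega> \<bullet> err k j \<omega> \<partial>M) = 0)"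

subsection \<open>Constants and the size of the limiting neighborhood\<close>

definition mean_upto :: "nat \<Rightarrow> (nat \<Rightarrow> real) \<Rightarrow> real" where
  "mean_upto n a = (1 / real n) * (\<Sum>i<n. a i)"

definition gamma_bar :: "nat \<Rightarrow> (nat \<Rightarrow> real) \<Rightarrow> (nat \<Rightarrow> real) \<Rightarrow> real" where
  "gamma_bar n \<mu> L = mean_upto n \<mu> * mean_upto n L / (mean_upto n \<mu> + mean_upto n L)"

definition c1 :: "nat \<Rightarrow> (nat \<Rightarrow> real) \<Rightarrow> (nat \<Rightarrow> real) \<Rightarrow> real \<Rightarrow> real \<Rightarrow> real" where
  "c1 n \<mu> L \<alpha> \<psi> = (1 + \<psi>) * (1 - 2 * \<alpha> * gamma_bar n \<mu> L)"

text \<open>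
  When $1 - 2\alpha\gamma_{\bar f} = 0$ (possible only if $\mu_{\bar f} = L_{\bar f} = 1/\alpha$) the
  upper bound on $\psi$ is read as $+\infty$; HOL's division by zero would make the case vacuous.
\<close>

definition admissible_psi :: "nat \<Rightarrow> (nat \<Rightarrow> real) \<Rightarrow> (nat \<Rightarrow> real) \<Rightarrow> real \<Rightarrow> real \<Rightarrow> bool" where
  "admissible_psi n \<mu> L \<alpha> \<psi> \<longleftrightarrow> \<psi> > 0 \<and>
     (1 - 2 * \<alpha> * gamma_bar n \<mu> L \<noteq> 0 \<longrightarrow>
        \<psi> < 2 * \<alpha> * gamma_bar n \<mu> L / (1 - 2 * \<alpha> * gamma_bar n \<mu> L))"

text \<open>
  The limit superior of the expected squared distance, as an extended nonnegative integral, so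
  that it is infinite rather than zero should a second moment fail to exist.
\<close>

definition limit_mean_square_error :: "'w measure \<Rightarrow> nat \<Rightarrow> (nat \<Rightarrow> nat \<Rightarrow> real) \<Rightarrow>
    (nat \<Rightarrow> real^'p \<Rightarrow> real) \<Rightarrow> (nat \<Rightarrow> real^'p \<Rightarrow> 'd \<Rightarrow> real^'p) \<Rightarrow> (nat \<Rightarrow> nat \<Rightarrow> 'w \<Rightarrow> 'd) \<Rightarrow>
    real \<Rightarrow> (nat \<Rightarrow> real^'p) \<Rightarrow> ennreal" where
  "limit_mean_square_error M n W f g \<xi> \<alpha> y0 =
     limsup (\<lambda>k. \<integral>\<^sup>+\<omega>. ennreal ((norm
       (near_dgd_avg n W \<alpha> g y0 (\<lambda>i k. \<xi> i k \<omega>) k - minimizer n f))\<^sup>2) \<partial>M)"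

end

theory Submission
  imports Defs
begin

text \<open>
  Averaging turns the iteration into a gradient step for the mean objective, perturbed by the
  deviation of the local gradients from their values at the average and by the mean gradient
  error. The mean step is a contraction by cocoercivity. Second moments stay bounded because the
  local gradient steps contract too, so the growing number of consensus rounds drives the
  consensus error to zero in mean square, and with it the deviation. Conditioning on an agent's
  own iterate does not make its error orthogonal to the average, but the resulting cross term
  vanishes together with the consensus error. What is left is the recursion
  $a_{k+1} \le c_1 a_k + \alpha^2 v + o(1)$, where $v$ bounds the variance of the mean error:
  $\sigma^2/n$ for uncorrelated errors and $\sigma^2$ otherwise.
\<close>

section \<open>Strongly convex and smooth functions\<close>

text \<open>The steplength condition does double duty. Agent by agent it makes the local steps
  contract, which bounds the second moments; averaged over the agents it becomes the condition under
  which the mean step contracts by 1 - 2 \<alpha> \<gamma>. The averaged constants are available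
  because convexity and smoothness are carried as a pair of quadratic bounds, and these are additive
  in the objective. The constant \<psi> is the weight in the Young inequality that separates the
  mean step from the gradient deviation: 1 + \<psi> inflates the contraction to \<open>c1\<close>,
  and the penalty 1 + 1/\<psi> falls only on a term that vanishes. The noise is kept out of this
  inequality and expanded exactly, so that its variance enters with the factor \<alpha> squared and
  nothing more; the price is a cross term that decays like the square root of the consensus error.
  Only decay of the consensus error is required, not a rate. Hence mixing can rest on a positive
  power of the matrix instead of its spectrum.\<close>

lemma smooth_quadratic_upper_bound:
  fixes f :: "'a::real_inner \<Rightarrow> real"
  assumes grad: "\<And>x. GDERIV f x :> D x" and lip: "L-lipschitz_on UNIV D"
  shows "f y \<le> f x + D x \<bullet> (y - x) + L / 2 * (norm (y - x))\<^sup>2"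
proof -
  define d where "d = y - x"
  \<comment> \<open>The excess of \<open>f\<close> along the segment over its quadratic model.
    Cauchy-Schwarz and the Lipschitz bound make its derivative nonpositive, so the gradient never
    has to be integrated.\<close>
  define \<phi> where "\<phi> = (\<lambda>t::real. f (x + t *\<^sub>R d) - t * (D x \<bullet> d) - L / 2 * t\<^sup>2 * (norm d)\<^sup>2)"
  have der: "DERIV (\<lambda>t. f (x + t *\<^sub>R d)) t :> D (x + t *\<^sub>R d) \<bullet> d" for t
  proof -
    have "((\<lambda>t. x + t *\<^sub>R d) has_derivative (\<lambda>h. h *\<^sub>R d)) (at t)"
      by (auto intro!: derivative_eq_intros)
    from has_derivative_compose[OF this] grad[of "x + t *\<^sub>R d"]
    have "((\<lambda>t. f (x + t *\<^sub>R d)) has_derivative (\<lambda>h. (h *\<^sub>R d) \<bullet> D (x + t *\<^sub>R d))) (at t)"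
      unfolding gderiv_def by blast
    then show ?thesis
      by (rule has_derivative_imp_has_field_derivative) (simp add: inner_commute)
  qed
  have "\<phi> 1 \<le> \<phi> 0"
  proof (rule DERIV_nonpos_imp_nonincreasing[where f = \<phi>])
    fix t :: real assume t: "0 \<le> t" "t \<le> 1"
    have "DERIV \<phi> t :> D (x + t *\<^sub>R d) \<bullet> d - D x \<bullet> d - L * t * (norm d)\<^sup>2"
      unfolding \<phi>_def
      by (rule derivative_eq_intros der refl | simp)+
    moreover have "(D (x + t *\<^sub>R d) - D x) \<bullet> d \<le> norm (D (x + t *\<^sub>R d) - D x) * norm d"
      by (rule norm_cauchy_schwarz)
    moreover have "norm (D (x + t *\<^sub>R d) - D x) \<le> L * (t * norm d)"
      using lipschitz_onD[OF lip, of "x + t *\<^sub>R d" x] t by (simp add: dist_norm)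
    then have "norm (D (x + t *\<^sub>R d) - D x) * norm d \<le> L * (t * norm d) * norm d"
      by (rule mult_right_mono) simp
    ultimately show "\<exists>y. DERIV \<phi> t :> y \<and> y \<le> 0"
      by (intro exI[of _ "D (x + t *\<^sub>R d) \<bullet> d - D x \<bullet> d - L * t * (norm d)\<^sup>2"])
        (auto simp: inner_diff_left power2_eq_square mult.assoc)
  qed simp
  then show ?thesis
    by (simp add: \<phi>_def d_def)
qed

text \<open>Divided by t, the convexity inequality bounds the difference quotient of
  \<open>f\<close> at x in the direction of y. As t tends to 0 from the right the quotient becomes
  the directional derivative and the factor 1 - t disappears.\<close>

lemma strongly_convex_quadratic_lower_bound:
  fixes f :: "'a::real_inner \<Rightarrow> real"
  assumes grad: "GDERIV f x :> D"
    and sc: "\<And>t. t \<in> {0..1} \<Longrightarrow> f (t *\<^sub>R y + (1 - t) *\<^sub>R x) \<le>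
        t * f y + (1 - t) * f x - \<mu> / 2 * t * (1 - t) * (norm (y - x))\<^sup>2"
  shows "f x + D \<bullet> (y - x) + \<mu> / 2 * (norm (y - x))\<^sup>2 \<le> f y"
proof -
  define d where "d = y - x"
  have "((\<lambda>t. x + t *\<^sub>R d) has_derivative (\<lambda>h. h *\<^sub>R d)) (at (0::real))"
    by (auto intro!: derivative_eq_intros)
  from has_derivative_compose[OF this, of f "\<lambda>h. h \<bullet> D"] grad
  have "((\<lambda>t. f (x + t *\<^sub>R d)) has_derivative (\<lambda>h. (h *\<^sub>R d) \<bullet> D)) (at 0)"
    unfolding gderiv_def by simp
  then have "DERIV (\<lambda>t. f (x + t *\<^sub>R d)) 0 :> D \<bullet> d"
    by (rule has_derivative_imp_has_field_derivative) (simp add: inner_commute)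
  then have "((\<lambda>h. (f (x + h *\<^sub>R d) - f x) / h) \<longlongrightarrow> D \<bullet> d) (at 0)"
    by (simp add: DERIV_def)
  then have lim: "((\<lambda>h. (f (x + h *\<^sub>R d) - f x) / h) \<longlongrightarrow> D \<bullet> d) (at_right 0)"
    by (rule filterlim_mono) (auto simp: at_le)
  have lim': "((\<lambda>h. f y - f x - \<mu> / 2 * (1 - h) * (norm d)\<^sup>2) \<longlongrightarrow>
      f y - f x - \<mu> / 2 * (1 - 0) * (norm d)\<^sup>2) (at_right (0::real))"
    by (intro tendsto_intros)
  have "D \<bullet> d \<le> f y - f x - \<mu> / 2 * (1 - 0) * (norm d)\<^sup>2"
  proof (rule tendsto_le[OF _ lim' lim])
    show "\<forall>\<^sub>F h in at_right 0. (f (x + h *\<^sub>R d) - f x) / h \<le> f y - f x - \<mu> / 2 * (1 - h) * (norm d)\<^sup>2"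
      unfolding eventually_at_right_field
    proof (intro exI[of _ 1] conjI allI impI)
      fix h :: real assume h: "0 < h" "h < 1"
      have "x + h *\<^sub>R d = h *\<^sub>R y + (1 - h) *\<^sub>R x"
        by (simp add: d_def algebra_simps)
      then have "f (x + h *\<^sub>R d) - f x \<le> (f y - f x - \<mu> / 2 * (1 - h) * (norm d)\<^sup>2) * h"
        using sc[of h] h by (simp add: d_def algebra_simps)
      then show "(f (x + h *\<^sub>R d) - f x) / h \<le> f y - f x - \<mu> / 2 * (1 - h) * (norm d)\<^sup>2"
        using h by (simp add: pos_divide_le_eq)
    qed simp
  qed simp
  then show ?thesis
    by (simp add: d_def)
qed

text \<open>The form of strong convexity and smoothness that survives averaging: both inequalities
  are jointly linear in the constants, the function and \<open>D\<close>. Cocoercivity, the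
  contraction of gradient steps and the existence of a minimizer are all derived from it.\<close>

definition quadratic_bounds ::
    "real \<Rightarrow> real \<Rightarrow> ('a::real_inner \<Rightarrow> real) \<Rightarrow> ('a \<Rightarrow> 'a) \<Rightarrow> bool" where
  "quadratic_bounds \<mu> L f D \<longleftrightarrow> (\<forall>x y.
     f x + D x \<bullet> (y - x) + \<mu> / 2 * (norm (y - x))\<^sup>2 \<le> f y \<and>
     f y \<le> f x + D x \<bullet> (y - x) + L / 2 * (norm (y - x))\<^sup>2)"

lemma quadratic_bounds_lower:
  "quadratic_bounds \<mu> L f D \<Longrightarrow> f x + D x \<bullet> (y - x) + \<mu> / 2 * (norm (y - x))\<^sup>2 \<le> f y"
  by (simp add: quadratic_bounds_def)

lemma quadratic_bounds_upper:
  "quadratic_bounds \<mu> L f D \<Longrightarrow> f y \<le> f x + D x \<bullet> (y - x) + L / 2 * (norm (y - x))\<^sup>2"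
  by (simp add: quadratic_bounds_def)

lemma quadratic_bounds_convex_combination:
  assumes "finite I" and "\<And>i. i \<in> I \<Longrightarrow> w i \<ge> 0"
    and qb: "\<And>i. i \<in> I \<Longrightarrow> quadratic_bounds (\<mu> i) (L i) (f i) (D i)"
  shows "quadratic_bounds (\<Sum>i\<in>I. w i * \<mu> i) (\<Sum>i\<in>I. w i * L i)
    (\<lambda>x. \<Sum>i\<in>I. w i * f i x) (\<lambda>x. \<Sum>i\<in>I. w i *\<^sub>R D i x)"
  unfolding quadratic_bounds_def
proof (intro allI conjI)
  fix x y
  have "(\<Sum>i\<in>I. w i * f i x) + (\<Sum>i\<in>I. w i *\<^sub>R D i x) \<bullet> (y - x) +
      (\<Sum>i\<in>I. w i * \<mu> i) / 2 * (norm (y - x))\<^sup>2 =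
      (\<Sum>i\<in>I. w i * (f i x + D i x \<bullet> (y - x) + \<mu> i / 2 * (norm (y - x))\<^sup>2))"
    by (simp add: inner_sum_left sum_divide_distrib sum_distrib_right sum.distrib distrib_left mult.assoc)
  also have "\<dots> \<le> (\<Sum>i\<in>I. w i * f i y)"
    by (intro sum_mono mult_left_mono quadratic_bounds_lower[OF qb] assms(2))
  finally show "(\<Sum>i\<in>I. w i * f i x) + (\<Sum>i\<in>I. w i *\<^sub>R D i x) \<bullet> (y - x) +
      (\<Sum>i\<in>I. w i * \<mu> i) / 2 * (norm (y - x))\<^sup>2 \<le> (\<Sum>i\<in>I. w i * f i y)" .
  have "(\<Sum>i\<in>I. w i * f i y) \<le>
      (\<Sum>i\<in>I. w i * (f i x + D i x \<bullet> (y - x) + L i / 2 * (norm (y - x))\<^sup>2))"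
    by (intro sum_mono mult_left_mono quadratic_bounds_upper[OF qb] assms(2))
  also have "\<dots> = (\<Sum>i\<in>I. w i * f i x) + (\<Sum>i\<in>I. w i *\<^sub>R D i x) \<bullet> (y - x) +
      (\<Sum>i\<in>I. w i * L i) / 2 * (norm (y - x))\<^sup>2"
    by (simp add: inner_sum_left sum_divide_distrib sum_distrib_right sum.distrib distrib_left mult.assoc)
  finally show "(\<Sum>i\<in>I. w i * f i y) \<le> (\<Sum>i\<in>I. w i * f i x) + (\<Sum>i\<in>I. w i *\<^sub>R D i x) \<bullet> (y - x) +
      (\<Sum>i\<in>I. w i * L i) / 2 * (norm (y - x))\<^sup>2" .
qed

text \<open>
  The Baillon--Haddad argument for the convex, $(L-\mu)$-smooth function
  $f - \frac{\mu}{2}\|\cdot\|^2$: compare the lower bound at \<open>y\<close> with the upper bound at \<open>x\<close>,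
  both evaluated at \<open>x - t w\<close> where \<open>w\<close> is the difference of its gradients.
\<close>

lemma quadratic_bounds_cocoercive:
  fixes f :: "'a::real_inner \<Rightarrow> real"
  assumes qb: "quadratic_bounds \<mu> L f D" and le: "\<mu> \<le> L"
  shows "(norm (D x - D y))\<^sup>2 + \<mu> * L * (norm (x - y))\<^sup>2 \<le> (\<mu> + L) * ((D x - D y) \<bullet> (x - y))"
proof -
  have half: "t * (norm w)\<^sup>2 - (L - \<mu>) / 2 * t\<^sup>2 * (norm w)\<^sup>2 \<le>
      f x - f y - D y \<bullet> (x - y) - \<mu> / 2 * (norm (x - y))\<^sup>2"
    if w: "w = (D x - \<mu> *\<^sub>R x) - (D y - \<mu> *\<^sub>R y)" for x y w and t :: real
  proof -
    define z where "z = x - t *\<^sub>R w"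
    have "f y + D y \<bullet> (z - y) + \<mu> / 2 * (norm (z - y))\<^sup>2 \<le>
        f x + D x \<bullet> (z - x) + L / 2 * (norm (z - x))\<^sup>2"
      using quadratic_bounds_lower[OF qb, of y z] quadratic_bounds_upper[OF qb, of z x] by linarith
    moreover have "D y \<bullet> (z - y) = D y \<bullet> (x - y) - t * (D y \<bullet> w)"
      "D x \<bullet> (z - x) = - t * (D x \<bullet> w)"
      by (simp_all add: z_def algebra_simps)
    moreover have "(norm (z - y))\<^sup>2 = (norm (x - y))\<^sup>2 - 2 * t * ((x - y) \<bullet> w) + t\<^sup>2 * (norm w)\<^sup>2"
      "(norm (z - x))\<^sup>2 = t\<^sup>2 * (norm w)\<^sup>2"
      unfolding z_def power2_norm_eq_inner
      by (simp_all add: inner_commute algebra_simps power2_eq_square)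
    moreover have "(norm w)\<^sup>2 = D x \<bullet> w - D y \<bullet> w - \<mu> * ((x - y) \<bullet> w)"
      unfolding power2_norm_eq_inner by (subst w) (simp add: algebra_simps)
    then have "t * (norm w)\<^sup>2 = t * (D x \<bullet> w) - t * (D y \<bullet> w) - t * \<mu> * ((x - y) \<bullet> w)"
      by (simp only: right_diff_distrib mult.assoc)
    ultimately show ?thesis
      by (simp add: algebra_simps diff_divide_distrib add_divide_distrib)
  qed
  define d where "d = x - y"
  define v where "v = D x - D y"
  define w where "w = v - \<mu> *\<^sub>R d"
  \<comment> \<open>Adding \<open>half\<close> for the pair and for the swapped pair, where
    \<open>w\<close> changes sign, cancels the function values.\<close>
  have both: "2 * t * (norm w)\<^sup>2 - (L - \<mu>) * t\<^sup>2 * (norm w)\<^sup>2 \<le> w \<bullet> d" for t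
  proof -
    have "t * (norm w)\<^sup>2 - (L - \<mu>) / 2 * t\<^sup>2 * (norm w)\<^sup>2 \<le>
        f x - f y - D y \<bullet> d - \<mu> / 2 * (norm d)\<^sup>2"
      unfolding d_def by (rule half) (simp add: w_def v_def d_def algebra_simps)
    moreover have "t * (norm w)\<^sup>2 - (L - \<mu>) / 2 * t\<^sup>2 * (norm w)\<^sup>2 \<le>
        f y - f x + D x \<bullet> d - \<mu> / 2 * (norm d)\<^sup>2"
      using half[of "- w" y x t]
      by (simp add: w_def v_def d_def algebra_simps norm_minus_commute)
    moreover have "w \<bullet> d = D x \<bullet> d - D y \<bullet> d - \<mu> * (norm d)\<^sup>2"
      unfolding w_def v_def by (simp add: power2_norm_eq_inner algebra_simps)
    moreover have "2 * P \<le> u" if "P \<le> a - b - q - N / 2" "P \<le> b - a + r - N / 2" "u = r - q - N"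
      for P a b q r u N :: real
      using that by linarith
    ultimately have "2 * (t * (norm w)\<^sup>2 - (L - \<mu>) / 2 * t\<^sup>2 * (norm w)\<^sup>2) \<le> w \<bullet> d"
      by (simp only: times_divide_eq_left)
    then show ?thesis
      by (simp add: right_diff_distrib mult.assoc)
  qed
  \<comment> \<open>In \<open>both\<close>, t is free. For \<mu> < L the left side is largest at t =
    1 / (L - \<mu>). For L = \<mu> it is linear in t, hence unbounded unless \<open>w\<close>
    vanishes; the t used there makes it exceed the right side by one.\<close>
  have "(norm w)\<^sup>2 \<le> (L - \<mu>) * (w \<bullet> d)"
  proof (cases "L = \<mu>")
    case True
    have "(norm w)\<^sup>2 = 0"
    proof (rule ccontr)
      assume "(norm w)\<^sup>2 \<noteq> 0"
      then have "2 * ((w \<bullet> d + 1) / (2 * (norm w)\<^sup>2)) * (norm w)\<^sup>2 = w \<bullet> d + 1"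
        by (simp add: field_simps)
      then show False
        using both[of "(w \<bullet> d + 1) / (2 * (norm w)\<^sup>2)"] True by simp
    qed
    then show ?thesis using True by simp
  next
    case False
    then have pos: "L - \<mu> > 0" using le by simp
    have "2 * (1 / K) * N - K * (1 / K)\<^sup>2 * N = N / K" if "K > 0" for K N :: real
      using that by (simp add: field_simps power2_eq_square)
    from this[OF pos] have "(norm w)\<^sup>2 / (L - \<mu>) \<le> w \<bullet> d"
      using both[of "1 / (L - \<mu>)"] by simp
    then show ?thesis
      using pos by (simp add: pos_divide_le_eq mult.commute)
  qed
  moreover have "(norm w)\<^sup>2 = (norm v)\<^sup>2 - 2 * \<mu> * (v \<bullet> d) + \<mu>\<^sup>2 * (norm d)\<^sup>2"
    unfolding w_def power2_norm_eq_inner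
    by (simp add: inner_commute algebra_simps power2_eq_square)
  moreover have "w \<bullet> d = v \<bullet> d - \<mu> * (norm d)\<^sup>2"
    unfolding w_def by (simp add: power2_norm_eq_inner algebra_simps)
  ultimately have "(norm v)\<^sup>2 + \<mu> * L * (norm d)\<^sup>2 \<le> (\<mu> + L) * (v \<bullet> d)"
    by (simp add: algebra_simps power2_eq_square)
  then show ?thesis
    by (simp add: v_def d_def)
qed

text \<open>Cocoercivity bounds the cross term of the expanded square by multiples of the squared
  gradient difference and the squared distance. The condition \<alpha> (\<mu> + L) \<le> 2 lets the
  first of these absorb the term of order \<alpha> squared; the second yields the factor.\<close>

lemma gradient_step_contraction:
  fixes f :: "'a::real_inner \<Rightarrow> real"
  assumes qb: "quadratic_bounds \<mu> L f D" and "0 < \<mu>" "\<mu> \<le> L"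
    and "0 < \<alpha>" "\<alpha> * (\<mu> + L) \<le> 2"
  shows "(norm ((x - \<alpha> *\<^sub>R D x) - (y - \<alpha> *\<^sub>R D y)))\<^sup>2 \<le>
    (1 - 2 * \<alpha> * (\<mu> * L / (\<mu> + L))) * (norm (x - y))\<^sup>2"
proof -
  define d v where "d = x - y" and "v = D x - D y"
  have pos: "\<mu> + L > 0" using assms by simp
  have "((norm v)\<^sup>2 + \<mu> * L * (norm d)\<^sup>2) / (\<mu> + L) \<le> v \<bullet> d"
    using quadratic_bounds_cocoercive[OF qb assms(3), of x y] pos
    by (simp add: d_def v_def pos_divide_le_eq mult.commute)
  then have "2 * \<alpha> * (((norm v)\<^sup>2 + \<mu> * L * (norm d)\<^sup>2) / (\<mu> + L)) \<le> 2 * \<alpha> * (v \<bullet> d)"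
    using assms by (intro mult_left_mono) auto
  moreover have "2 * \<alpha> * (((norm v)\<^sup>2 + \<mu> * L * (norm d)\<^sup>2) / (\<mu> + L)) =
      \<alpha> * (2 / (\<mu> + L)) * (norm v)\<^sup>2 + 2 * \<alpha> * (\<mu> * L / (\<mu> + L)) * (norm d)\<^sup>2"
    by (simp add: add_divide_distrib algebra_simps)
  moreover have "\<alpha> * \<alpha> * (norm v)\<^sup>2 \<le> \<alpha> * (2 / (\<mu> + L)) * (norm v)\<^sup>2"
    using assms pos by (intro mult_right_mono mult_left_mono) (auto simp: pos_le_divide_eq)
  moreover have "(norm (d - \<alpha> *\<^sub>R v))\<^sup>2 = (norm d)\<^sup>2 - 2 * \<alpha> * (v \<bullet> d) + \<alpha> * \<alpha> * (norm v)\<^sup>2"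
    by (simp add: power2_norm_eq_inner algebra_simps inner_commute)
  ultimately have "(norm (d - \<alpha> *\<^sub>R v))\<^sup>2 \<le> (1 - 2 * \<alpha> * (\<mu> * L / (\<mu> + L))) * (norm d)\<^sup>2"
    by (simp add: algebra_simps)
  then show ?thesis
    by (simp add: d_def v_def algebra_simps)
qed

text \<open>The inequality of arithmetic and geometric means gives 2 \<alpha> \<mu> L / (\<mu> + L)
  \<le> \<alpha> (\<mu> + L) / 2, which the steplength condition bounds by one. Nonnegativity
  matters for the square root in the fixed-point argument and for the sign of
  \<open>c1\<close>.\<close>

lemma contraction_factor_bounds:
  fixes \<alpha> \<mu> L :: real
  assumes "0 < \<mu>" "\<mu> \<le> L" "0 < \<alpha>" "\<alpha> * (\<mu> + L) \<le> 2"
  shows "0 \<le> 1 - 2 * \<alpha> * (\<mu> * L / (\<mu> + L))" and "1 - 2 * \<alpha> * (\<mu> * L / (\<mu> + L)) < 1"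
proof -
  have pos: "\<mu> + L > 0" using assms by simp
  have "4 * (\<mu> * L) \<le> (\<mu> + L)\<^sup>2"
    using zero_le_power2[of "\<mu> - L"] by (simp add: power2_eq_square algebra_simps)
  then have "4 * (\<mu> * L / (\<mu> + L)) \<le> \<mu> + L"
    using pos by (simp add: pos_divide_le_eq power2_eq_square)
  then have "\<alpha> * (4 * (\<mu> * L / (\<mu> + L))) \<le> \<alpha> * (\<mu> + L)"
    using assms by (intro mult_left_mono) auto
  then have "2 * (2 * \<alpha> * (\<mu> * L / (\<mu> + L))) \<le> 2"
    using assms(4) by (simp only: mult.assoc mult.left_commute[of \<alpha>])
  then show "0 \<le> 1 - 2 * \<alpha> * (\<mu> * L / (\<mu> + L))"
    by linarith
  show "1 - 2 * \<alpha> * (\<mu> * L / (\<mu> + L)) < 1"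
    using assms pos by simp
qed

text \<open>Compare the two bounds around 0 at a unit vector. Such a vector exists because the index
  type of \<open>real^'p\<close> is nonempty; on the trivial space the bounds would hold for any two
  constants.\<close>

lemma quadratic_bounds_le:
  fixes f :: "real^'p \<Rightarrow> real"
  assumes "quadratic_bounds \<mu> L f D"
  shows "\<mu> \<le> L"
proof -
  obtain x :: "real^'p" where "norm x = 1"
    using vector_choose_size[of 1] by auto
  then show ?thesis
    using quadratic_bounds_lower[OF assms, of 0 x] quadratic_bounds_upper[OF assms, of x 0] by simp
qed

text \<open>The minimizer is found as the fixed point of a gradient step.\<close>

lemma quadratic_bounds_minimizer:
  fixes f :: "real^'p \<Rightarrow> real"
  assumes qb: "quadratic_bounds \<mu> L f D" and pos: "0 < \<mu>"
  obtains x where "D x = 0" and "\<And>y. f x \<le> f y" and "\<And>y. (\<forall>z. f y \<le> f z) \<Longrightarrow> y = x"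
proof -
  note le = quadratic_bounds_le[OF qb]
  define \<alpha> where "\<alpha> = 2 / (\<mu> + L)"
  have \<alpha>: "0 < \<alpha>" "\<alpha> * (\<mu> + L) \<le> 2"
  proof -
    have "\<mu> + L > 0" using pos le by simp
    then show "0 < \<alpha>" "\<alpha> * (\<mu> + L) \<le> 2"
      by (simp_all add: \<alpha>_def pos_divide_le_eq)
  qed
  define c where "c = 1 - 2 * \<alpha> * (\<mu> * L / (\<mu> + L))"
  have c: "0 \<le> c" "c < 1"
    unfolding c_def using contraction_factor_bounds[OF pos le \<alpha>] by auto
  \<comment> \<open>The factor \<open>c\<close> belongs to squared distances, so the Banach
    fixed-point theorem is applied with \<open>sqrt c\<close>.\<close>
  have "\<exists>!x. x - \<alpha> *\<^sub>R D x = x"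
  proof (rule banach_fix_type)
    show "\<forall>x y. dist (x - \<alpha> *\<^sub>R D x) (y - \<alpha> *\<^sub>R D y) \<le> sqrt c * dist x y"
    proof (intro allI)
      fix x y
      have "(dist (x - \<alpha> *\<^sub>R D x) (y - \<alpha> *\<^sub>R D y))\<^sup>2 \<le> c * (dist x y)\<^sup>2"
        unfolding dist_norm c_def by (rule gradient_step_contraction[OF qb pos le \<alpha>])
      also have "\<dots> = (sqrt c * dist x y)\<^sup>2"
        using c(1) by (simp add: power_mult_distrib)
      finally have "(dist (x - \<alpha> *\<^sub>R D x) (y - \<alpha> *\<^sub>R D y))\<^sup>2 \<le> (sqrt c * dist x y)\<^sup>2" .
      then show "dist (x - \<alpha> *\<^sub>R D x) (y - \<alpha> *\<^sub>R D y) \<le> sqrt c * dist x y"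
        by (rule power2_le_imp_le) (simp add: c(1))
    qed
  qed (simp_all add: c)
  then obtain x where "x - \<alpha> *\<^sub>R D x = x" by blast
  then have zero: "D x = 0" using \<alpha> by simp
  \<comment> \<open>With a vanishing gradient the lower quadratic bound becomes quadratic growth
    around x, which gives minimality and uniqueness at once.\<close>
  have lower: "f x + \<mu> / 2 * (norm (y - x))\<^sup>2 \<le> f y" for y
    using quadratic_bounds_lower[OF qb, of x y] zero by simp
  show ?thesis
  proof (rule that[OF zero])
    show "f x \<le> f y" for y
    proof -
      have "0 \<le> \<mu> / 2 * (norm (y - x))\<^sup>2"
        using pos by simp
      with lower[of y] show ?thesis by linarith
    qed
    show "y = x" if "\<forall>z. f y \<le> f z" for y
    proof -
      have "\<mu> / 2 * (norm (y - x))\<^sup>2 \<le> 0"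
        using lower[of y] that[rule_format, of x] by simp
      then show ?thesis
        using pos by (simp add: mult_le_0_iff)
    qed
  qed
qed

text \<open>\<open>gradient\<close> is a definite description, so uniqueness is needed besides
  existence: two candidates induce the same derivative, and testing it on their difference shows
  that they agree.\<close>

lemma smooth_with_GDERIV:
  assumes "smooth_with L f"
  shows "GDERIV f x :> gradient f x"
proof -
  from assms obtain D where D: "GDERIV f x :> D"
    by (auto simp: smooth_with_def)
  have "D' = D" if "GDERIV f x :> D'" for D'
  proof -
    have "(\<lambda>h. h \<bullet> D') = (\<lambda>h. h \<bullet> D)"
      using that D unfolding gderiv_def by (rule has_derivative_unique)
    then have "(D' - D) \<bullet> (D' - D) = 0"
      by (metis inner_diff_right right_minus_eq)
    then show ?thesis by simp
  qed
  then show ?thesis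
    unfolding gradient_def using D by (metis theI)
qed

lemma smooth_strongly_convex_quadratic_bounds:
  assumes "smooth_with L f" and "strongly_convex_with \<mu> f"
  shows "quadratic_bounds \<mu> L f (gradient f)"
  unfolding quadratic_bounds_def
proof (intro allI conjI)
  fix x y
  show "f x + gradient f x \<bullet> (y - x) + \<mu> / 2 * (norm (y - x))\<^sup>2 \<le> f y"
    using assms(2)
    by (intro strongly_convex_quadratic_lower_bound smooth_with_GDERIV[OF assms(1)])
      (auto simp: strongly_convex_with_def)
  show "f y \<le> f x + gradient f x \<bullet> (y - x) + L / 2 * (norm (y - x))\<^sup>2"
    using assms(1)
    by (intro smooth_quadratic_upper_bound smooth_with_GDERIV[OF assms(1)])
      (auto simp: smooth_with_def)
qed

section \<open>Mixing by the consensus matrix\<close>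

text \<open>The triangle inequality followed by Jensen's inequality for the square.\<close>

lemma norm_convex_combination_power2:
  fixes v :: "'i \<Rightarrow> 'a::real_normed_vector"
  assumes "finite I" "\<And>i. i \<in> I \<Longrightarrow> w i \<ge> 0" "(\<Sum>i\<in>I. w i) = 1"
  shows "(norm (\<Sum>i\<in>I. w i *\<^sub>R v i))\<^sup>2 \<le> (\<Sum>i\<in>I. w i * (norm (v i))\<^sup>2)"
proof -
  have "I \<noteq> {}" using assms(3) by auto
  have "norm (\<Sum>i\<in>I. w i *\<^sub>R v i) \<le> (\<Sum>i\<in>I. w i * norm (v i))"
    using assms(2) by (intro order_trans[OF norm_sum] sum_mono) simp
  then have "(norm (\<Sum>i\<in>I. w i *\<^sub>R v i))\<^sup>2 \<le> (\<Sum>i\<in>I. w i *\<^sub>R norm (v i))\<^sup>2"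
    by (simp add: power_mono)
  also have "\<dots> \<le> (\<Sum>i\<in>I. w i * (norm (v i))\<^sup>2)"
    using assms \<open>I \<noteq> {}\<close> by (intro convex_on_sum[OF _ _ convex_power2]) auto
  finally show ?thesis .
qed

text \<open>Facts about blocks hold only below \<open>n\<close>, while stacked vectors are total
  functions. This lets such facts be used under a further round of consensus.\<close>

lemma consensus_cong:
  "(\<And>j. j < n \<Longrightarrow> v j = v' j) \<Longrightarrow> consensus n W v = consensus n W v'"
  by (simp add: consensus_def)

text \<open>The entries of the k-th power of W. The dimension is a variable number rather than a
  type, so matrices are functions of two indices.\<close>

primrec matrix_power :: "nat \<Rightarrow> (nat \<Rightarrow> nat \<Rightarrow> real) \<Rightarrow> nat \<Rightarrow> nat \<Rightarrow> nat \<Rightarrow> real" where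
  "matrix_power n W 0 = (\<lambda>i j. of_bool (i = j))"
| "matrix_power n W (Suc k) = (\<lambda>i j. \<Sum>l<n. W i l * matrix_power n W k l j)"

lemma consensus_pow_eq:
  assumes "i < n"
  shows "(consensus n W ^^ k) v i = (\<Sum>j<n. matrix_power n W k i j *\<^sub>R v j)"
  using assms
proof (induction k arbitrary: i)
  case 0
  then show ?case
    by (simp add: of_bool_def if_distrib[of "\<lambda>c. c *\<^sub>R _"] cong: if_cong)
next
  case (Suc k)
  have "(consensus n W ^^ Suc k) v i = (\<Sum>l<n. \<Sum>j<n. (W i l * matrix_power n W k l j) *\<^sub>R v j)"
    by (simp add: consensus_def Suc.IH scaleR_sum_right)
  also have "\<dots> = (\<Sum>j<n. \<Sum>l<n. (W i l * matrix_power n W k l j) *\<^sub>R v j)"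
    by (rule sum.swap)
  finally show ?case by (simp add: scaleR_sum_left)
qed

section \<open>Double stochasticity: preserved sums and nonexpansiveness\<close>

context
  fixes n E W
  assumes cm: "consensus_matrix n E W"
begin

lemma consensus_matrix_nonneg: "i < n \<Longrightarrow> j < n \<Longrightarrow> 0 \<le> W i j"
  and consensus_matrix_row_sum: "i < n \<Longrightarrow> (\<Sum>j<n. W i j) = 1"
  and consensus_matrix_column_sum: "j < n \<Longrightarrow> (\<Sum>i<n. W i j) = 1"
  and consensus_matrix_diagonal_pos: "i < n \<Longrightarrow> 0 < W i i"
  using cm by (simp_all add: consensus_matrix_def)

lemma consensus_matrix_edge_pos:
  assumes "i < n" "j < n" "(i, j) \<in> E"
  shows "0 < W i j"
  using cm assms consensus_matrix_diagonal_pos[of i]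
  by (cases "i = j") (auto simp: consensus_matrix_def)

lemma consensus_diff_const:
  assumes "i < n"
  shows "consensus n W (\<lambda>j. v j - u) i = consensus n W v i - u"
proof -
  have "consensus n W (\<lambda>j. v j - u) i = consensus n W v i - (\<Sum>j<n. W i j) *\<^sub>R u"
    by (simp add: consensus_def scaleR_diff_right sum_subtractf scaleR_sum_left)
  then show ?thesis using assms by (simp add: consensus_matrix_row_sum)
qed

lemma consensus_pow_diff_const:
  assumes "i < n"
  shows "(consensus n W ^^ k) (\<lambda>j. v j - u) i = (consensus n W ^^ k) v i - u"
  using assms
proof (induction k arbitrary: i)
  case (Suc k)
  then show ?case by (simp add: consensus_diff_const cong: consensus_cong)
qed simp

lemma consensus_sum: "(\<Sum>i<n. consensus n W v i) = (\<Sum>i<n. v i)"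
proof -
  have "(\<Sum>i<n. consensus n W v i) = (\<Sum>j<n. \<Sum>i<n. W i j *\<^sub>R v j)"
    unfolding consensus_def by (rule sum.swap)
  also have "\<dots> = (\<Sum>j<n. v j)"
    by (simp add: scaleR_sum_left[symmetric] consensus_matrix_column_sum)
  finally show ?thesis .
qed

lemma consensus_pow_sum: "(\<Sum>i<n. (consensus n W ^^ k) v i) = (\<Sum>i<n. v i)"
  by (induction k) (simp_all add: consensus_sum)

text \<open>Jensen along each row; exchanging the sums then leaves column sums, which are one. The
  estimate holds for the sum over agents, not block by block.\<close>

lemma consensus_sum_norm_power2_le:
  "(\<Sum>i<n. (norm (consensus n W v i))\<^sup>2) \<le> (\<Sum>i<n. (norm (v i))\<^sup>2)"
proof -
  have "(\<Sum>i<n. (norm (consensus n W v i))\<^sup>2) \<le> (\<Sum>i<n. \<Sum>j<n. W i j * (norm (v j))\<^sup>2)"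
    unfolding consensus_def
    by (intro sum_mono norm_convex_combination_power2)
      (auto simp: consensus_matrix_nonneg consensus_matrix_row_sum)
  also have "\<dots> = (\<Sum>j<n. \<Sum>i<n. W i j * (norm (v j))\<^sup>2)"
    by (rule sum.swap)
  also have "\<dots> = (\<Sum>j<n. (norm (v j))\<^sup>2)"
    by (simp add: sum_distrib_right[symmetric] consensus_matrix_column_sum)
  finally show ?thesis .
qed

lemma consensus_pow_sum_norm_power2_le:
  "(\<Sum>i<n. (norm ((consensus n W ^^ k) v i))\<^sup>2) \<le> (\<Sum>i<n. (norm (v i))\<^sup>2)"
  by (induction k) (auto intro: order_trans[OF consensus_sum_norm_power2_le])

section \<open>Primitivity: some power of the consensus matrix is entrywise positive\<close>

lemma matrix_power_nonneg: "i < n \<Longrightarrow> j < n \<Longrightarrow> 0 \<le> matrix_power n W k i j"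
  by (induction k arbitrary: i) (auto intro!: sum_nonneg mult_nonneg_nonneg consensus_matrix_nonneg)

lemma matrix_power_row_sum:
  assumes "i < n"
  shows "(\<Sum>j<n. matrix_power n W k i j) = 1"
  using assms
proof (induction k arbitrary: i)
  case (Suc k)
  have "(\<Sum>j<n. matrix_power n W (Suc k) i j) = (\<Sum>l<n. \<Sum>j<n. W i l * matrix_power n W k l j)"
    unfolding matrix_power.simps by (rule sum.swap)
  also have "\<dots> = 1"
    using Suc by (simp add: sum_distrib_left[symmetric] consensus_matrix_row_sum)
  finally show ?case .
qed (simp add: of_bool_def)

lemma matrix_power_Suc_pos:
  assumes "i < n" "l < n" "j < n" "0 < W i l" "0 < matrix_power n W k l j"
  shows "0 < matrix_power n W (Suc k) i j"
proof -
  have "0 < W i l * matrix_power n W k l j"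
    using assms by simp
  also have "\<dots> \<le> (\<Sum>l<n. W i l * matrix_power n W k l j)"
    using assms
    by (intro member_le_sum) (auto intro!: mult_nonneg_nonneg consensus_matrix_nonneg matrix_power_nonneg)
  finally show ?thesis by simp
qed

text \<open>The positive diagonal lets a walk pause at its current agent, so an entry that is
  positive once stays positive. This is where periodicity of the network is ruled out as an
  obstacle.\<close>

lemma matrix_power_pos_mono:
  assumes "i < n" "j < n" "0 < matrix_power n W k i j" "k \<le> k'"
  shows "0 < matrix_power n W k' i j"
  using assms(4,1-3)
  by (induction rule: dec_induct) (auto intro: matrix_power_Suc_pos consensus_matrix_diagonal_pos simp del: matrix_power.simps)

text \<open>A path in the network is prepended edge by edge; since all entries are nonnegative, the
  contribution of this one walk cannot be cancelled.\<close>

lemma matrix_power_connected_pos: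
  assumes sub: "E \<subseteq> {..<n} \<times> {..<n}" and "(i, j) \<in> E\<^sup>*" "j < n"
  shows "\<exists>k. 0 < matrix_power n W k i j"
  using assms(2)
proof (induction rule: converse_rtrancl_induct)
  case base
  have "0 < matrix_power n W 0 j j" by simp
  then show ?case ..
next
  case (step i l)
  then obtain k where "0 < matrix_power n W k l j" by blast
  moreover have "i < n" "l < n" using step(1) sub by auto
  ultimately show ?case
    using \<open>j < n\<close> step(1) by (blast intro: matrix_power_Suc_pos consensus_matrix_edge_pos)
qed

lemma matrix_power_eventually_pos:
  assumes "connected_network n E"
  shows "\<exists>k>0. \<forall>i<n. \<forall>j<n. 0 < matrix_power n W k i j"
proof -
  have "\<exists>k. 0 < matrix_power n W k i j" if "i < n" "j < n" for i j
    using assms that by (intro matrix_power_connected_pos) (auto simp: connected_network_def)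
  then obtain K where K: "\<And>i j. i < n \<Longrightarrow> j < n \<Longrightarrow> 0 < matrix_power n W (K i j) i j"
    by metis
  \<comment> \<open>The sum dominates every individual exponent, and \<open>Suc\<close> makes the
    common exponent positive, as needed when it later serves as a block length.\<close>
  define k where "k = Suc (\<Sum>i<n. \<Sum>j<n. K i j)"
  have "0 < matrix_power n W k i j" if "i < n" "j < n" for i j
  proof (rule matrix_power_pos_mono[OF that K[OF that]])
    have "K i j \<le> (\<Sum>j<n. K i j)"
      using that by (intro member_le_sum) auto
    also have "\<dots> \<le> (\<Sum>i<n. \<Sum>j<n. K i j)"
      using that by (intro member_le_sum[of i "{..<n}" "\<lambda>i. \<Sum>j<n. K i j"]) auto
    finally show "K i j \<le> k" by (simp add: k_def)
  qed
  then show ?thesis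
    by (intro exI[of _ k]) (simp add: k_def)
qed

section \<open>From a positive power to geometric decay on zero-sum vectors\<close>

lemma consensus_pow_norm_le:
  assumes "\<And>j. j < n \<Longrightarrow> norm (v j) \<le> B" and "i < n"
  shows "norm ((consensus n W ^^ k) v i) \<le> B"
proof -
  have "norm ((consensus n W ^^ k) v i) \<le> (\<Sum>j<n. matrix_power n W k i j * norm (v j))"
    unfolding consensus_pow_eq[OF assms(2)]
    using assms(2) by (intro order_trans[OF norm_sum] sum_mono) (simp add: matrix_power_nonneg)
  also have "\<dots> \<le> (\<Sum>j<n. matrix_power n W k i j * B)"
    using assms by (intro sum_mono mult_left_mono) (auto simp: matrix_power_nonneg)
  also have "\<dots> = B"
    using assms(2) by (simp add: sum_distrib_right[symmetric] matrix_power_row_sum)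
  finally show ?thesis .
qed

text \<open>
  On vectors whose entries sum to zero, subtracting a constant from each row of a positive
  matrix changes nothing; what remains of row \<open>i\<close> has total mass less than one.
\<close>

lemma consensus_pow_contraction:
  assumes "connected_network n E" "n \<ge> 1"
  obtains m q where "0 < m" "0 \<le> q" "q < 1"
    "\<And>v :: nat \<Rightarrow> real^'p. \<And>B i. (\<Sum>j<n. v j) = 0 \<Longrightarrow> (\<And>j. j < n \<Longrightarrow> norm (v j) \<le> B) \<Longrightarrow> i < n \<Longrightarrow>
      norm ((consensus n W ^^ m) v i) \<le> q * B"
proof -
  obtain m where m: "m > 0" "\<And>i j. i < n \<Longrightarrow> j < n \<Longrightarrow> 0 < matrix_power n W m i j"
    using matrix_power_eventually_pos[OF assms(1)] by blast
  define P where "P = matrix_power n W m"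
  \<comment> \<open>The smallest entry of the positive power. Every row dominates \<open>n\<close>
    copies of it and sums to one, so 1 - n \<delta> lies in [0, 1).\<close>
  define \<delta> where "\<delta> = Min ((\<lambda>(i, j). P i j) ` ({..<n} \<times> {..<n}))"
  have ne: "{..<n} \<times> {..<n} \<noteq> {}" using assms(2) by (auto simp: lessThan_empty_iff)
  have \<delta>_pos: "\<delta> > 0"
    unfolding \<delta>_def using ne m(2) by (subst Min_gr_iff) (auto simp: P_def)
  have \<delta>_le: "\<delta> \<le> P i j" if "i < n" "j < n" for i j
    unfolding \<delta>_def using that by (intro Min_le) (auto intro!: image_eqI[of _ _ "(i, j)"])
  have row: "(\<Sum>j<n. P i j - \<delta>) = 1 - real n * \<delta>" if "i < n" for i
    using that by (simp add: sum_subtractf P_def matrix_power_row_sum)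
  show ?thesis
  proof (rule that[OF m(1), of "1 - real n * \<delta>"])
    show "0 \<le> 1 - real n * \<delta>"
      using row[of 0] sum_nonneg[of "{..<n}" "\<lambda>j. P 0 j - \<delta>"] \<delta>_le[of 0] assms(2) by simp
    show "1 - real n * \<delta> < 1"
      using \<delta>_pos assms(2) by simp
    fix v :: "nat \<Rightarrow> real^'p" and B i
    assume v: "(\<Sum>j<n. v j) = 0" "\<And>j. j < n \<Longrightarrow> norm (v j) \<le> B" and i: "i < n"
    have "(consensus n W ^^ m) v i = (\<Sum>j<n. P i j *\<^sub>R v j) - \<delta> *\<^sub>R (\<Sum>j<n. v j)"
      using i v(1) by (simp add: consensus_pow_eq P_def)
    also have "\<dots> = (\<Sum>j<n. (P i j - \<delta>) *\<^sub>R v j)"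
      by (simp add: scaleR_diff_left sum_subtractf scaleR_sum_right)
    also have "norm \<dots> \<le> (\<Sum>j<n. (P i j - \<delta>) * B)"
      using i v(2) \<delta>_le
      by (intro order_trans[OF norm_sum] sum_mono) (auto intro!: mult_left_mono)
    also have "\<dots> = (1 - real n * \<delta>) * B"
      by (simp add: sum_distrib_right[symmetric] row[OF i])
    finally show "norm ((consensus n W ^^ m) v i) \<le> (1 - real n * \<delta>) * B" .
  qed
qed

text \<open>Each full block of \<open>m\<close> rounds contracts the largest block norm by
  \<open>q\<close>, and the remaining \<open>k mod m\<close> rounds do not increase it. The result
  is stated with sums of squares because those are the quantities whose expectations are
  bounded.\<close>

lemma consensus_mixing:
  assumes "connected_network n E" "n \<ge> 1"
  obtains r :: "nat \<Rightarrow> real" where "r \<longlonglongrightarrow> 0" "\<And>k. 0 \<le> r k"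
    "\<And>k (v :: nat \<Rightarrow> real^'p) i. (\<Sum>j<n. v j) = 0 \<Longrightarrow> i < n \<Longrightarrow>
      (norm ((consensus n W ^^ k) v i))\<^sup>2 \<le> r k * (\<Sum>j<n. (norm (v j))\<^sup>2)"
proof -
  obtain m q where m: "0 < m" and q: "0 \<le> q" "q < 1" and contr:
    "\<And>v :: nat \<Rightarrow> real^'p. \<And>B i. (\<Sum>j<n. v j) = 0 \<Longrightarrow> (\<And>j. j < n \<Longrightarrow> norm (v j) \<le> B) \<Longrightarrow> i < n \<Longrightarrow>
      norm ((consensus n W ^^ m) v i) \<le> q * B"
    using consensus_pow_contraction[OF assms] by metis
  have mult: "norm ((consensus n W ^^ (m * a)) v i) \<le> q ^ a * B"
    if "(\<Sum>j<n. v j) = 0" "\<And>j. j < n \<Longrightarrow> norm (v j) \<le> B" "i < n" for a and v :: "nat \<Rightarrow> real^'p" and B i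
    using that(3)
  proof (induction a arbitrary: i)
    case (Suc a)
    \<comment> \<open>Consensus preserves the zero sum, so the one-block contraction applies
      again.\<close>
    have "norm ((consensus n W ^^ m) ((consensus n W ^^ (m * a)) v) i) \<le> q * (q ^ a * B)"
      using Suc that(1) by (intro contr) (auto simp: consensus_pow_sum)
    then show ?case by (simp add: funpow_add)
  qed (use that in simp)
  show ?thesis
  proof (rule that[of "\<lambda>k. (q ^ (k div m))\<^sup>2"])
    have "filterlim (\<lambda>k. k div m) at_top sequentially"
      unfolding filterlim_at_top
    proof
      fix Z
      show "\<forall>\<^sub>F k in sequentially. Z \<le> k div m"
        using eventually_ge_at_top[of "Z * m"]
        by eventually_elim (use m in \<open>simp add: less_eq_div_iff_mult_less_eq\<close>)
    qed
    then have "(\<lambda>k. q ^ (k div m)) \<longlonglongrightarrow> 0"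
      using LIMSEQ_power_zero[of q] q filterlim_compose by fastforce
    from tendsto_power[OF this, of 2] show "(\<lambda>k. (q ^ (k div m))\<^sup>2) \<longlonglongrightarrow> 0"
      by simp
  next
    fix k i and v :: "nat \<Rightarrow> real^'p"
    assume v: "(\<Sum>j<n. v j) = 0" and i: "i < n"
    \<comment> \<open>The Euclidean norm of the stacked vector bounds each of its blocks; this
      converts between the maximum norm and sums of squares.\<close>
    define B where "B = sqrt (\<Sum>j<n. (norm (v j))\<^sup>2)"
    have B: "norm (v j) \<le> B" if "j < n" for j
      unfolding B_def using that
      by (intro real_le_rsqrt member_le_sum[of j "{..<n}" "\<lambda>j. (norm (v j))\<^sup>2"]) auto
    have "norm ((consensus n W ^^ (k mod m)) ((consensus n W ^^ (m * (k div m))) v) i) \<le> q ^ (k div m) * B"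
      using i by (intro consensus_pow_norm_le mult v B)
    then have "norm ((consensus n W ^^ k) v i) \<le> q ^ (k div m) * B"
      by (metis comp_apply funpow_add mod_mult_div_eq)
    then have "(norm ((consensus n W ^^ k) v i))\<^sup>2 \<le> (q ^ (k div m) * B)\<^sup>2"
      by (intro power_mono) auto
    also have "\<dots> = (q ^ (k div m))\<^sup>2 * (\<Sum>j<n. (norm (v j))\<^sup>2)"
      unfolding B_def by (simp add: power_mult_distrib sum_nonneg)
    finally show "(norm ((consensus n W ^^ k) v i))\<^sup>2 \<le> (q ^ (k div m))\<^sup>2 * (\<Sum>j<n. (norm (v j))\<^sup>2)" .
  qed simp
qed

end

section \<open>Square-integrable random vectors\<close>

text \<open>Young's inequality with a free weight, obtained by expanding the square of \<eta> a - b
  divided by \<eta>.\<close>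

lemma norm_add_power2_le:
  fixes a b :: "'a::real_inner"
  assumes "\<eta> > 0"
  shows "(norm (a + b))\<^sup>2 \<le> (1 + \<eta>) * (norm a)\<^sup>2 + (1 + 1 / \<eta>) * (norm b)\<^sup>2"
proof -
  have "0 \<le> (norm (\<eta> *\<^sub>R a - b))\<^sup>2 / \<eta>"
    using assms by simp
  also have "\<dots> = \<eta> * (norm a)\<^sup>2 - 2 * (a \<bullet> b) + (norm b)\<^sup>2 / \<eta>"
    using assms unfolding power2_norm_eq_inner
    by (simp add: algebra_simps inner_commute diff_divide_distrib add_divide_distrib)
  finally show ?thesis
    unfolding power2_norm_eq_inner by (simp add: algebra_simps inner_commute)
qed

lemma norm_add_power2_le_double:
  fixes a b :: "'a::real_inner"
  shows "(norm (a + b))\<^sup>2 \<le> 2 * (norm a)\<^sup>2 + 2 * (norm b)\<^sup>2"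
  using norm_add_power2_le[of 1 a b] by simp

lemma norm_diff_power2_le_double:
  fixes a b :: "'a::real_inner"
  shows "(norm (a - b))\<^sup>2 \<le> 2 * (norm a)\<^sup>2 + 2 * (norm b)\<^sup>2"
  using norm_add_power2_le_double[of a "- b"] by simp

lemma abs_inner_le_power2:
  fixes a b :: "'a::real_inner"
  shows "\<bar>a \<bullet> b\<bar> \<le> (norm a)\<^sup>2 + (norm b)\<^sup>2"
proof -
  have "\<bar>a \<bullet> b\<bar> \<le> norm a * norm b"
    by (rule Cauchy_Schwarz_ineq2)
  also have "\<dots> \<le> (norm a)\<^sup>2 + (norm b)\<^sup>2"
    using zero_le_power2[of "norm a - norm b"] mult_nonneg_nonneg[OF norm_ge_zero[of a] norm_ge_zero[of b]]
    unfolding power2_diff by linarith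
  finally show ?thesis .
qed

text \<open>Expanded around the mean, the sum of squares has no cross term, because deviations from
  the mean add up to zero.\<close>

lemma sum_norm_diff_mean_le:
  fixes v :: "nat \<Rightarrow> 'a::real_inner"
  assumes "n \<ge> 1"
  shows "(\<Sum>i<n. (norm (v i - (1 / real n) *\<^sub>R (\<Sum>j<n. v j)))\<^sup>2) \<le> (\<Sum>i<n. (norm (v i - u))\<^sup>2)"
proof -
  define m where "m = (1 / real n) *\<^sub>R (\<Sum>j<n. v j)"
  have "(norm (v i - u))\<^sup>2 = (norm (v i - m))\<^sup>2 + 2 * ((v i - m) \<bullet> (m - u)) + (norm (m - u))\<^sup>2" for i
    unfolding power2_norm_eq_inner by (simp add: algebra_simps inner_commute)
  then have "(\<Sum>i<n. (norm (v i - u))\<^sup>2) =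
      (\<Sum>i<n. (norm (v i - m))\<^sup>2) + 2 * ((\<Sum>i<n. v i - m) \<bullet> (m - u)) + real n * (norm (m - u))\<^sup>2"
    by (simp add: sum.distrib inner_sum_left sum_distrib_left)
  moreover have "(\<Sum>i<n. v i - m) = 0"
    using assms by (simp add: m_def sum_subtractf sum_constant_scaleR)
  ultimately show ?thesis
    by (simp add: m_def)
qed

text \<open>Membership in L^2. Measurability of the vector is a separate conjunct since it does not
  follow from integrability of the squared norm.\<close>

definition square_integrable :: "'w measure \<Rightarrow> ('w \<Rightarrow> 'a::euclidean_space) \<Rightarrow> bool" where
  "square_integrable M X \<longleftrightarrow> X \<in> borel_measurable M \<and> integrable M (\<lambda>\<omega>. (norm (X \<omega>))\<^sup>2)"

lemma square_integrable_measurable: "square_integrable M X \<Longrightarrow> X \<in> borel_measurable M"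
  and square_integrable_norm: "square_integrable M X \<Longrightarrow> integrable M (\<lambda>\<omega>. (norm (X \<omega>))\<^sup>2)"
  by (simp_all add: square_integrable_def)

lemma square_integrable_add [intro]:
  assumes "square_integrable M X" "square_integrable M Y"
  shows "square_integrable M (\<lambda>\<omega>. X \<omega> + Y \<omega>)"
  unfolding square_integrable_def
proof
  note [measurable] = assms[THEN square_integrable_measurable]
  show "(\<lambda>\<omega>. X \<omega> + Y \<omega>) \<in> borel_measurable M" by measurable
  have "integrable M (\<lambda>\<omega>. 2 * (norm (X \<omega>))\<^sup>2 + 2 * (norm (Y \<omega>))\<^sup>2)"
    using assms[THEN square_integrable_norm] by simp
  then show "integrable M (\<lambda>\<omega>. (norm (X \<omega> + Y \<omega>))\<^sup>2)"
    by (rule Bochner_Integration.integrable_bound) (auto simp: norm_add_power2_le_double)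
qed

lemma square_integrable_scaleR [intro]:
  "square_integrable M X \<Longrightarrow> square_integrable M (\<lambda>\<omega>. c *\<^sub>R X \<omega>)"
  by (auto simp: square_integrable_def power_mult_distrib)

lemma square_integrable_diff [intro]:
  "square_integrable M X \<Longrightarrow> square_integrable M Y \<Longrightarrow> square_integrable M (\<lambda>\<omega>. X \<omega> - Y \<omega>)"
  using square_integrable_add[of M X "\<lambda>\<omega>. (- 1) *\<^sub>R Y \<omega>"] square_integrable_scaleR[of M Y "- 1"] by simp

lemma (in finite_measure) square_integrable_const [intro]: "square_integrable M (\<lambda>\<omega>. c)"
  by (simp add: square_integrable_def)

lemma (in finite_measure) square_integrable_sum [intro]:
  "(\<And>i. i \<in> I \<Longrightarrow> square_integrable M (X i)) \<Longrightarrow> square_integrable M (\<lambda>\<omega>. \<Sum>i\<in>I. X i \<omega>)"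
  by (induction I rule: infinite_finite_induct) auto

text \<open>A Lipschitz map grows at most linearly; finiteness of the measure takes care of the
  constant \<open>h 0\<close>.\<close>

lemma (in finite_measure) square_integrable_lipschitz:
  assumes lip: "C-lipschitz_on UNIV h" and X: "square_integrable M X"
  shows "square_integrable M (\<lambda>\<omega>. h (X \<omega>))"
  unfolding square_integrable_def
proof
  have "continuous_on UNIV h"
    using lip by (rule lipschitz_on_continuous_on)
  then have [measurable]: "h \<in> borel_measurable borel"
    by (rule borel_measurable_continuous_onI)
  note [measurable] = square_integrable_measurable[OF X]
  show "(\<lambda>\<omega>. h (X \<omega>)) \<in> borel_measurable M" by measurable
  have "integrable M (\<lambda>\<omega>. 2 * (C\<^sup>2 * (norm (X \<omega>))\<^sup>2) + 2 * (norm (h 0))\<^sup>2)"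
    using square_integrable_norm[OF X] by simp
  then show "integrable M (\<lambda>\<omega>. (norm (h (X \<omega>)))\<^sup>2)"
  proof (rule Bochner_Integration.integrable_bound)
    have "(norm (h x))\<^sup>2 \<le> 2 * (C\<^sup>2 * (norm x)\<^sup>2) + 2 * (norm (h 0))\<^sup>2" for x
    proof -
      have "(norm (h x - h 0))\<^sup>2 \<le> (C * norm x)\<^sup>2"
        using lipschitz_onD[OF lip, of x 0] by (intro power_mono) (auto simp: dist_norm)
      then show ?thesis
        using norm_add_power2_le_double[of "h x - h 0" "h 0"] by (simp add: power_mult_distrib)
    qed
    then show "AE \<omega> in M. norm ((norm (h (X \<omega>)))\<^sup>2) \<le> norm (2 * (C\<^sup>2 * (norm (X \<omega>))\<^sup>2) + 2 * (norm (h 0))\<^sup>2)"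
      by simp
  qed measurable
qed

lemma square_integrable_inner:
  assumes "square_integrable M X" "square_integrable M Y"
  shows "integrable M (\<lambda>\<omega>. X \<omega> \<bullet> Y \<omega>)"
proof -
  note [measurable] = assms[THEN square_integrable_measurable]
  have "integrable M (\<lambda>\<omega>. (norm (X \<omega>))\<^sup>2 + (norm (Y \<omega>))\<^sup>2)"
    using assms[THEN square_integrable_norm] by simp
  then show ?thesis
    by (rule Bochner_Integration.integrable_bound) (auto simp: abs_inner_le_power2)
qed

lemma square_integrable_component:
  fixes X :: "'w \<Rightarrow> real^'p"
  assumes "square_integrable M X"
  shows "square_integrable M (\<lambda>\<omega>. X \<omega> $ c)"
  unfolding square_integrable_def
proof
  note [measurable] = square_integrable_measurable[OF assms]
  have "(\<lambda>x::real^'p. x $ c) \<in> borel_measurable borel"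
    by (intro borel_measurable_continuous_onI continuous_intros)
  then show meas: "(\<lambda>\<omega>. X \<omega> $ c) \<in> borel_measurable M"
    by measurable
  show "integrable M (\<lambda>\<omega>. (norm (X \<omega> $ c))\<^sup>2)"
    using square_integrable_norm[OF assms]
  proof (rule Bochner_Integration.integrable_bound)
    show "AE \<omega> in M. norm ((norm (X \<omega> $ c))\<^sup>2) \<le> norm ((norm (X \<omega>))\<^sup>2)"
      by (simp add: component_le_norm_cart abs_le_square_iff[symmetric])
  qed (use meas in measurable)
qed

section \<open>The inner product of square-integrable random vectors\<close>

lemma expectation_norm_diff_power2:
  assumes X: "square_integrable M X" and Y: "square_integrable M Y"
  shows "(\<integral>\<omega>. (norm (X \<omega> - t *\<^sub>R Y \<omega>))\<^sup>2 \<partial>M) =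
    (\<integral>\<omega>. (norm (X \<omega>))\<^sup>2 \<partial>M) - 2 * t * (\<integral>\<omega>. X \<omega> \<bullet> Y \<omega> \<partial>M) + t\<^sup>2 * (\<integral>\<omega>. (norm (Y \<omega>))\<^sup>2 \<partial>M)"
proof -
  have "(norm (X \<omega> - t *\<^sub>R Y \<omega>))\<^sup>2 = (norm (X \<omega>))\<^sup>2 - 2 * t * (X \<omega> \<bullet> Y \<omega>) + t\<^sup>2 * (norm (Y \<omega>))\<^sup>2" for \<omega>
    unfolding power2_norm_eq_inner by (simp add: algebra_simps inner_commute power2_eq_square)
  then show ?thesis
    using square_integrable_norm[OF X] square_integrable_norm[OF Y] square_integrable_inner[OF X Y]
    by simp
qed

text \<open>The second moment of X - t Y is nonnegative for every t; its minimum over t gives the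
  inequality.\<close>

lemma expectation_Cauchy_Schwarz:
  assumes X: "square_integrable M X" and Y: "square_integrable M Y"
  shows "\<bar>\<integral>\<omega>. X \<omega> \<bullet> Y \<omega> \<partial>M\<bar> \<le> sqrt ((\<integral>\<omega>. (norm (X \<omega>))\<^sup>2 \<partial>M) * (\<integral>\<omega>. (norm (Y \<omega>))\<^sup>2 \<partial>M))"
proof -
  define a b c where "a = (\<integral>\<omega>. (norm (X \<omega>))\<^sup>2 \<partial>M)" and "b = (\<integral>\<omega>. X \<omega> \<bullet> Y \<omega> \<partial>M)"
    and "c = (\<integral>\<omega>. (norm (Y \<omega>))\<^sup>2 \<partial>M)"
  have quad: "0 \<le> a - 2 * t * b + t\<^sup>2 * c" for t
    unfolding a_def b_def c_def expectation_norm_diff_power2[OF X Y, symmetric] by simp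
  have "0 \<le> c" by (simp add: c_def)
  have "b\<^sup>2 \<le> a * c"
  proof (cases "c = 0")
    case True
    have "b = 0"
    proof (rule ccontr)
      assume "b \<noteq> 0"
      \<comment> \<open>With \<open>c = 0\<close> the quadratic is affine in t, and this choice of t
        gives it the value -1.\<close>
      then have "2 * ((a + 1) / (2 * b)) * b = a + 1" by simp
      then show False using quad[of "(a + 1) / (2 * b)"] True by simp
    qed
    then show ?thesis using True by simp
  next
    case False
    have "a - 2 * (b / c) * b + (b / c)\<^sup>2 * c = a - b\<^sup>2 / c"
      using False by (simp add: field_simps power2_eq_square)
    then have "b\<^sup>2 / c \<le> a" using quad[of "b / c"] by simp
    then show ?thesis using False \<open>0 \<le> c\<close> by (simp add: pos_divide_le_eq)
  qed
  then show ?thesis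
    unfolding a_def b_def c_def by (rule real_le_rsqrt[of "\<bar>_\<bar>", unfolded power2_abs])
qed

section \<open>Stochastic gradient errors\<close>

context prob_space
begin

context
  fixes f :: "real^'p \<Rightarrow> real" and X G \<sigma>
  assumes sg: "stochastic_gradient_of M f \<sigma> X G"
    and X_meas: "X \<in> borel_measurable M"
    and grad_meas: "gradient f \<in> borel_measurable borel"
begin

lemma subalgebra_generated_algebra: "subalgebra M (generated_algebra M X)"
  unfolding subalgebra_def generated_algebra_def
  using sets_image_in_sets[OF refl X_meas] by simp

lemma sigma_finite_generated_algebra: "sigma_finite_subalgebra M (generated_algebra M X)"
  by (intro finite_measure_subalgebra_is_sigma_finite finite_measure_subalgebra.intro
      finite_measure_subalgebra_axioms.intro finite_measure_axioms subalgebra_generated_algebra)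

lemma generated_algebra_measurable: "X \<in> borel_measurable (generated_algebra M X)"
  unfolding generated_algebra_def by (rule measurable_vimage_algebra1) simp

lemma stochastic_gradient_measurable: "G \<in> borel_measurable M"
  using sg by (auto simp: stochastic_gradient_of_def)

lemma gradient_error_measurable: "(\<lambda>\<omega>. G \<omega> - gradient f (X \<omega>)) \<in> borel_measurable M"
  using stochastic_gradient_measurable X_meas grad_meas by measurable

text \<open>The tower property. It is stated for the extended integral because integrability of the
  squared error is not yet known; it follows from this bound.\<close>

lemma gradient_error_nn_integral_le:
  "(\<integral>\<^sup>+\<omega>. ennreal ((norm (G \<omega> - gradient f (X \<omega>)))\<^sup>2) \<partial>M) \<le> ennreal (\<sigma>\<^sup>2)"
proof -
  note [measurable] = gradient_error_measurable
  let ?e = "\<lambda>\<omega>. ennreal ((norm (G \<omega> - gradient f (X \<omega>)))\<^sup>2)"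
  interpret sigma_finite_subalgebra M "generated_algebra M X"
    by (rule sigma_finite_generated_algebra)
  \<comment> \<open>The factor 1 is the test function in the characterization of the conditional
    expectation.\<close>
  have "(\<integral>\<^sup>+\<omega>. ?e \<omega> \<partial>M) = (\<integral>\<^sup>+\<omega>. 1 * ?e \<omega> \<partial>M)"
    by simp
  also have "\<dots> = (\<integral>\<^sup>+\<omega>. 1 * nn_cond_exp M (generated_algebra M X) ?e \<omega> \<partial>M)"
    by (rule nn_cond_exp_intg[symmetric]) measurable
  also have "\<dots> \<le> (\<integral>\<^sup>+\<omega>. ennreal (\<sigma>\<^sup>2) \<partial>M)"
    using sg by (intro nn_integral_mono_AE) (simp add: stochastic_gradient_of_def)
  also have "\<dots> = ennreal (\<sigma>\<^sup>2)"
    by (simp add: emeasure_space_1)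
  finally show ?thesis .
qed

lemma gradient_error_square_integrable: "square_integrable M (\<lambda>\<omega>. G \<omega> - gradient f (X \<omega>))"
  unfolding square_integrable_def
proof
  note [measurable] = gradient_error_measurable
  show "(\<lambda>\<omega>. G \<omega> - gradient f (X \<omega>)) \<in> borel_measurable M" by measurable
  show "integrable M (\<lambda>\<omega>. (norm (G \<omega> - gradient f (X \<omega>)))\<^sup>2)"
    using gradient_error_nn_integral_le
    by (intro integrableI_nonneg) (auto intro: le_less_trans)
qed

lemma gradient_error_expectation_le: "expectation (\<lambda>\<omega>. (norm (G \<omega> - gradient f (X \<omega>)))\<^sup>2) \<le> \<sigma>\<^sup>2"
proof -
  note [measurable] = gradient_error_measurable
  have "ennreal (expectation (\<lambda>\<omega>. (norm (G \<omega> - gradient f (X \<omega>)))\<^sup>2)) \<le> ennreal (\<sigma>\<^sup>2)"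
    using gradient_error_nn_integral_le square_integrable_norm[OF gradient_error_square_integrable]
    by (subst nn_integral_eq_integral[symmetric]) auto
  then show ?thesis by simp
qed

text \<open>\<open>h (X \<omega>)\<close> is measurable for the algebra generated by
  \<open>X\<close> and can therefore be moved through the conditional expectation, coordinate by
  coordinate; square integrability makes the products integrable. Functions that also depend on
  other agents' iterates are not covered.\<close>

lemma gradient_error_orthogonal:
  assumes h: "h \<in> borel_measurable borel" and hX: "square_integrable M (\<lambda>\<omega>. h (X \<omega>))"
    and gX: "square_integrable M (\<lambda>\<omega>. gradient f (X \<omega>))"
  shows "expectation (\<lambda>\<omega>. h (X \<omega>) \<bullet> (G \<omega> - gradient f (X \<omega>))) = 0"
proof -
  interpret F: sigma_finite_subalgebra M "generated_algebra M X"
    by (rule sigma_finite_generated_algebra)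
  have G: "square_integrable M G"
    using square_integrable_add[OF gradient_error_square_integrable gX] by simp
  note comp = hX[THEN square_integrable_component] G[THEN square_integrable_component]
    gX[THEN square_integrable_component]
  note [measurable] = h generated_algebra_measurable comp[THEN square_integrable_measurable] grad_meas X_meas
  have [measurable]: "(\<lambda>x::real^'p. x $ c) \<in> borel_measurable borel" for c
    by (intro borel_measurable_continuous_onI continuous_intros)
  have int: "integrable M (\<lambda>\<omega>. h (X \<omega>) $ c * G \<omega> $ c)" "integrable M (\<lambda>\<omega>. h (X \<omega>) $ c * gradient f (X \<omega>) $ c)" for c
    using square_integrable_inner[OF comp(1) comp(2)] square_integrable_inner[OF comp(1) comp(3)]
    by simp_all
  have eq: "expectation (\<lambda>\<omega>. h (X \<omega>) $ c * G \<omega> $ c) = expectation (\<lambda>\<omega>. h (X \<omega>) $ c * gradient f (X \<omega>) $ c)" for c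
  proof -
    have hm: "(\<lambda>\<omega>. h (X \<omega>) $ c) \<in> borel_measurable (generated_algebra M X)"
      by measurable
    have Gm: "(\<lambda>\<omega>. G \<omega> $ c) \<in> borel_measurable M"
      by measurable
    have "expectation (\<lambda>\<omega>. h (X \<omega>) $ c * G \<omega> $ c) =
        expectation (\<lambda>\<omega>. h (X \<omega>) $ c * real_cond_exp M (generated_algebra M X) (\<lambda>\<omega>. G \<omega> $ c) \<omega>)"
      by (rule F.real_cond_exp_intg(2)[OF int(1) hm Gm, symmetric])
    also have "\<dots> = expectation (\<lambda>\<omega>. h (X \<omega>) $ c * gradient f (X \<omega>) $ c)"
    proof (rule integral_cong_AE)
      have "AE \<omega> in M. real_cond_exp M (generated_algebra M X) (\<lambda>\<omega>. G \<omega> $ c) \<omega> = gradient f (X \<omega>) $ c"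
        using sg by (simp add: stochastic_gradient_of_def)
      then show "AE \<omega> in M. h (X \<omega>) $ c * real_cond_exp M (generated_algebra M X) (\<lambda>\<omega>. G \<omega> $ c) \<omega> =
          h (X \<omega>) $ c * gradient f (X \<omega>) $ c"
        by eventually_elim simp
    qed measurable
    finally show ?thesis .
  qed
  have "expectation (\<lambda>\<omega>. h (X \<omega>) \<bullet> (G \<omega> - gradient f (X \<omega>))) =
      expectation (\<lambda>\<omega>. \<Sum>c\<in>UNIV. h (X \<omega>) $ c * G \<omega> $ c - h (X \<omega>) $ c * gradient f (X \<omega>) $ c)"
    by (simp add: inner_vec_def right_diff_distrib)
  also have "\<dots> = 0"
    using int by (simp add: eq)
  finally show ?thesis .
qed

end

end

section \<open>Perturbed linear recursions\<close>

text \<open>\<open>D\<close> is the fixed point of the unperturbed recursion. The distance above it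
  shrinks by \<open>c\<close> in every step, up to a perturbation that is eventually small.\<close>

lemma recursion_eventually_le:
  fixes b r :: "nat \<Rightarrow> real"
  assumes rec: "\<And>k. b (Suc k) \<le> c * b k + d + r k" and c: "0 \<le> c" "c < 1"
    and r: "r \<longlonglongrightarrow> 0" and "\<epsilon> > 0"
  shows "\<forall>\<^sub>F k in sequentially. b k \<le> d / (1 - c) + \<epsilon>"
proof -
  define D where "D = d / (1 - c)"
  have D: "c * D + d = D"
    using c by (simp add: D_def field_simps)
  \<comment> \<open>Perturbations of size \<rho> accumulate to at most \<rho> / (1 - c), which this
    choice makes \<epsilon> / 2.\<close>
  define \<rho> where "\<rho> = \<epsilon> / 2 * (1 - c)"
  have "\<rho> > 0" using assms by (simp add: \<rho>_def)
  then obtain K where K: "\<And>k. k \<ge> K \<Longrightarrow> r k \<le> \<rho>"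
    using LIMSEQ_D[OF r, of \<rho>] by (force simp: abs_less_iff)
  have le: "b (K + m) - D \<le> c ^ m * \<bar>b K - D\<bar> + \<epsilon> / 2" for m
  proof (induction m)
    case (Suc m)
    have "b (K + Suc m) - D \<le> c * (b (K + m) - D) + \<rho>"
      using rec[of "K + m"] K[of "K + m"] D by (simp add: algebra_simps)
    also have "\<dots> \<le> c * (c ^ m * \<bar>b K - D\<bar> + \<epsilon> / 2) + \<rho>"
      using Suc c by (intro add_right_mono mult_left_mono) auto
    also have "\<dots> = c ^ Suc m * \<bar>b K - D\<bar> + \<epsilon> / 2"
      by (simp add: \<rho>_def field_simps)
    finally show ?case .
  qed (use assms in simp)
  have "(\<lambda>m. c ^ m * \<bar>b K - D\<bar>) \<longlonglongrightarrow> 0"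
    using c by (intro tendsto_mult_left_zero LIMSEQ_power_zero) simp
  then have "\<forall>\<^sub>F m in sequentially. c ^ m * \<bar>b K - D\<bar> < \<epsilon> / 2"
    by (rule order_tendstoD) (use assms in simp)
  then have "\<forall>\<^sub>F m in sequentially. b (m + K) \<le> D + \<epsilon>"
  proof eventually_elim
    case (elim m)
    then show ?case using le[of m] by (simp add: add.commute)
  qed
  then show ?thesis
    unfolding D_def by (rule eventually_sequentially_seg[THEN iffD1])
qed

lemma recursion_limsup_le:
  fixes b r :: "nat \<Rightarrow> real"
  assumes "\<And>k. b (Suc k) \<le> c * b k + d + r k" "0 \<le> c" "c < 1" "r \<longlonglongrightarrow> 0" "0 \<le> d"
  shows "limsup (\<lambda>k. ennreal (b k)) \<le> ennreal (d / (1 - c))"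
proof (rule ennreal_le_epsilon)
  fix \<epsilon> :: real assume "\<epsilon> > 0"
  have "limsup (\<lambda>k. ennreal (b k)) \<le> ennreal (d / (1 - c) + \<epsilon>)"
    using recursion_eventually_le[OF assms(1-4) \<open>\<epsilon> > 0\<close>]
    by (intro Limsup_bounded) (auto elim!: eventually_mono intro: ennreal_leI)
  \<comment> \<open>Nonnegativity of \<open>d\<close> allows \<open>ennreal\<close> to be split over
    the sum.\<close>
  then show "limsup (\<lambda>k. ennreal (b k)) \<le> ennreal (d / (1 - c)) + ennreal \<epsilon>"
    using assms \<open>\<epsilon> > 0\<close> by (simp add: ennreal_plus)
qed

lemma recursion_bounded:
  fixes b :: "nat \<Rightarrow> real"
  assumes "\<And>k. b (Suc k) \<le> q * b k + D" "0 \<le> q" "q < 1" "0 \<le> D" "0 \<le> b 0"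
  shows "b k \<le> b 0 + D / (1 - q)"
proof (induction k)
  case (Suc k)
  have "b (Suc k) \<le> q * (b 0 + D / (1 - q)) + D"
    using assms(1)[of k] mult_left_mono[OF Suc assms(2)] by linarith
  also have "q * (b 0 + D / (1 - q)) + D = q * b 0 + D / (1 - q)"
    using assms by (simp add: field_simps)
  also have "\<dots> \<le> b 0 + D / (1 - q)"
    using assms by (simp add: mult_left_le_one_le)
  finally show ?case .
qed (use assms in simp)

section \<open>The stochastic NEAR-DGD+ iteration\<close>

context stochastic_near_dgd
begin

section \<open>The iteration along one sample path and the exact recursion of its average\<close>

definition local_var where
  "local_var k i \<omega> = near_dgd_y n W \<alpha> g y0 (\<lambda>i k. \<xi> i k \<omega>) k i"

definition iterate where
  "iterate k i \<omega> = near_dgd_x n W \<alpha> g y0 (\<lambda>i k. \<xi> i k \<omega>) k i"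

definition average where
  "average k \<omega> = near_dgd_avg n W \<alpha> g y0 (\<lambda>i k. \<xi> i k \<omega>) k"

definition gradient_error where
  "gradient_error k i \<omega> = g i (iterate k i \<omega>) (\<xi> i k \<omega>) - gradient (f i) (iterate k i \<omega>)"

text \<open>The weights stand inside the sum, here and in the two definitions of mean quantities
  below, to match the lemmas on weighted combinations.\<close>

definition mean_gradient where
  "mean_gradient x = (\<Sum>i<n. (1 / real n) *\<^sub>R gradient (f i) x)"

definition mean_step where
  "mean_step x = x - \<alpha> *\<^sub>R mean_gradient x"

definition gradient_deviation where
  "gradient_deviation k \<omega> =
    (\<Sum>i<n. (1 / real n) *\<^sub>R (gradient (f i) (iterate k i \<omega>) - gradient (f i) (average k \<omega>)))"

definition mean_error where
  "mean_error k \<omega> = (\<Sum>i<n. (1 / real n) *\<^sub>R gradient_error k i \<omega>)"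

text \<open>The factor by which the mean gradient step contracts squared distances;
  \<open>c1\<close> is 1 + \<psi> times it.\<close>

definition contraction where
  "contraction = 1 - 2 * \<alpha> * gamma_bar n \<mu> L"

lemma local_var_0: "local_var 0 i \<omega> = y0 i"
  by (simp add: local_var_def)

lemma iterate_eq: "iterate k i \<omega> = (consensus n W ^^ k) (\<lambda>j. local_var k j \<omega>) i"
  by (simp add: iterate_def near_dgd_x_def local_var_def)

lemma local_var_Suc:
  "local_var (Suc k) i \<omega> =
    iterate k i \<omega> - \<alpha> *\<^sub>R gradient (f i) (iterate k i \<omega>) - \<alpha> *\<^sub>R gradient_error k i \<omega>"
  by (simp add: local_var_def iterate_def gradient_error_def near_dgd_x_def Let_def algebra_simps)

lemma average_iterate: "average k \<omega> = (\<Sum>i<n. (1 / real n) *\<^sub>R iterate k i \<omega>)"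
  by (simp add: average_def near_dgd_avg_def iterate_def scaleR_sum_right)

text \<open>Column sums of one make mixing invisible to the average. Consequently the number of
  rounds does not occur in the recursion of the average.\<close>

lemma average_local_var: "average k \<omega> = (1 / real n) *\<^sub>R (\<Sum>i<n. local_var k i \<omega>)"
  unfolding average_iterate iterate_eq
  by (simp add: scaleR_sum_right[symmetric] consensus_pow_sum[OF consensus])

lemma average_Suc:
  "average (Suc k) \<omega> = mean_step (average k \<omega>) - \<alpha> *\<^sub>R gradient_deviation k \<omega> - \<alpha> *\<^sub>R mean_error k \<omega>"
  unfolding average_local_var[of "Suc k"] local_var_Suc mean_step_def mean_gradient_def
    gradient_deviation_def mean_error_def
  by (simp add: average_iterate[of k] sum_subtractf scaleR_diff_right scaleR_sum_right
      mult.commute[of \<alpha>])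

subsection \<open>Gradient steps\<close>

lemma objective_quadratic_bounds: "i < n \<Longrightarrow> quadratic_bounds (\<mu> i) (L i) (f i) (gradient (f i))"
  using smooth strongly_convex by (rule smooth_strongly_convex_quadratic_bounds)

lemma \<mu>_pos: "i < n \<Longrightarrow> 0 < \<mu> i"
  using strongly_convex by (simp add: strongly_convex_with_def)

lemma \<mu>_le_L: "i < n \<Longrightarrow> \<mu> i \<le> L i"
  using objective_quadratic_bounds by (rule quadratic_bounds_le)

lemma steplength_local:
  assumes "i < n"
  shows "\<alpha> * (\<mu> i + L i) \<le> 2"
proof -
  have "(MIN i\<in>{..<n}. 2 / (\<mu> i + L i)) \<le> 2 / (\<mu> i + L i)"
    using assms by (intro Min_le) auto
  then have "\<alpha> \<le> 2 / (\<mu> i + L i)"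
    using steplength by linarith
  moreover have "\<mu> i + L i > 0"
    using \<mu>_pos[OF assms] \<mu>_le_L[OF assms] by simp
  ultimately show ?thesis
    by (simp add: pos_le_divide_eq)
qed

lemma gradient_lipschitz: "i < n \<Longrightarrow> (L i)-lipschitz_on UNIV (gradient (f i))"
  using smooth by (simp add: smooth_with_def)

lemma gradient_measurable: "i < n \<Longrightarrow> gradient (f i) \<in> borel_measurable borel"
  using gradient_lipschitz
  by (intro borel_measurable_continuous_onI lipschitz_on_continuous_on)

lemma mean_quadratic_bounds:
  "quadratic_bounds (mean_upto n \<mu>) (mean_upto n L) (\<lambda>x. \<Sum>i<n. (1 / real n) * f i x) mean_gradient"
proof -
  have "quadratic_bounds (\<Sum>i<n. (1 / real n) * \<mu> i) (\<Sum>i<n. (1 / real n) * L i)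
      (\<lambda>x. \<Sum>i<n. (1 / real n) * f i x) (\<lambda>x. \<Sum>i<n. (1 / real n) *\<^sub>R gradient (f i) x)"
    by (intro quadratic_bounds_convex_combination objective_quadratic_bounds) auto
  then show ?thesis
    by (simp only: mean_upto_def sum_distrib_left mean_gradient_def[abs_def])
qed

lemma mean_\<mu>_pos: "0 < mean_upto n \<mu>"
  unfolding mean_upto_def using agents \<mu>_pos
  by (intro mult_pos_pos sum_pos) (auto simp: lessThan_empty_iff)

lemma mean_\<mu>_le_L: "mean_upto n \<mu> \<le> mean_upto n L"
  using mean_quadratic_bounds by (rule quadratic_bounds_le)

text \<open>In the form \<alpha> (\<mu> + L) \<le> 2 the local conditions are linear in the
  constants and can be averaged.\<close>

lemma steplength_mean: "\<alpha> * (mean_upto n \<mu> + mean_upto n L) \<le> 2"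
proof -
  have "\<alpha> * (mean_upto n \<mu> + mean_upto n L) = 1 / real n * (\<Sum>i<n. \<alpha> * (\<mu> i + L i))"
    by (simp add: mean_upto_def sum.distrib sum_distrib_left distrib_left mult.left_commute)
  also have "\<dots> \<le> 1 / real n * (\<Sum>i<n. 2)"
    by (intro mult_left_mono sum_mono steplength_local) auto
  also have "\<dots> = 2"
    using agents by simp
  finally show ?thesis .
qed

lemma contraction_nonneg: "0 \<le> contraction"
  and contraction_less_1: "contraction < 1"
  unfolding contraction_def gamma_bar_def
  using contraction_factor_bounds[OF mean_\<mu>_pos mean_\<mu>_le_L steplength_pos steplength_mean] by auto

lemma mean_step_contraction: "(norm (mean_step x - mean_step y))\<^sup>2 \<le> contraction * (norm (x - y))\<^sup>2"
  unfolding contraction_def gamma_bar_def mean_step_def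
  by (rule gradient_step_contraction[OF mean_quadratic_bounds mean_\<mu>_pos mean_\<mu>_le_L
        steplength_pos steplength_mean])

lemma mean_step_lipschitz: "1-lipschitz_on UNIV mean_step"
proof (rule lipschitz_onI)
  fix x y :: "real^'p"
  have "contraction * (norm (x - y))\<^sup>2 \<le> 1 * (norm (x - y))\<^sup>2"
    using contraction_less_1 by (intro mult_right_mono) auto
  then have "(norm (mean_step x - mean_step y))\<^sup>2 \<le> (norm (x - y))\<^sup>2"
    using mean_step_contraction[of x y] by linarith
  then show "dist (mean_step x) (mean_step y) \<le> 1 * dist x y"
    by (simp add: dist_norm)
qed simp

text \<open>The factor 1/n does not move minimizers, and uniqueness forces the choice made by
  \<open>ARG_MIN\<close> to be the zero of the mean gradient.\<close>

lemma mean_step_minimizer: "mean_step (minimizer n f) = minimizer n f"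
proof -
  obtain x where x: "mean_gradient x = 0"
    and min: "\<And>y. (\<Sum>i<n. (1 / real n) * f i x) \<le> (\<Sum>i<n. (1 / real n) * f i y)"
    and unique: "\<And>y. (\<forall>z. (\<Sum>i<n. (1 / real n) * f i y) \<le> (\<Sum>i<n. (1 / real n) * f i z)) \<Longrightarrow> y = x"
    by (rule quadratic_bounds_minimizer[OF mean_quadratic_bounds mean_\<mu>_pos]) blast
  have le_iff: "(\<Sum>i<n. (1 / real n) * f i y) \<le> (\<Sum>i<n. (1 / real n) * f i z) \<longleftrightarrow>
      (\<Sum>i<n. f i y) \<le> (\<Sum>i<n. f i z)" for y z
    using agents by (simp add: sum_divide_distrib[symmetric] divide_le_cancel)
  have "minimizer n f = x"
    unfolding minimizer_def
    by (rule arg_minI[where x = x]) (use min unique in \<open>auto simp only: le_iff not_less\<close>)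
  then show ?thesis
    using x by (simp add: mean_step_def)
qed

subsection \<open>Second moments\<close>

text \<open>Conditional on the local variables of the same iteration, because it is used inside the
  induction that establishes their square integrability.\<close>

lemma square_integrable_iterate:
  assumes "\<And>j. j < n \<Longrightarrow> square_integrable M (local_var k j)" and "i < n"
  shows "square_integrable M (iterate k i)"
proof -
  have "square_integrable M (\<lambda>\<omega>. \<Sum>j<n. matrix_power n W k i j *\<^sub>R local_var k j \<omega>)"
    using assms by (intro square_integrable_sum square_integrable_scaleR) auto
  then show ?thesis
    using assms(2) by (simp add: iterate_eq[abs_def] consensus_pow_eq)
qed

lemma square_integrable_error:
  assumes "i < n" and X: "square_integrable M (iterate k i)"
  shows "square_integrable M (gradient_error k i)"
  using gradient_error_square_integrable[OF stochastic_gradients[OF assms(1)]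
      square_integrable_measurable[OF X, unfolded iterate_def[abs_def]] gradient_measurable[OF assms(1)]]
  by (simp add: gradient_error_def[abs_def] iterate_def)

text \<open>The start is deterministic. In each step mixing and the Lipschitz gradients preserve
  square integrability, and the new error has it by its variance bound.\<close>

lemma square_integrable_local_var: "i < n \<Longrightarrow> square_integrable M (local_var k i)"
proof (induction k arbitrary: i)
  case 0
  then show ?case
    using square_integrable_const by (simp add: local_var_0[abs_def])
next
  case (Suc k)
  have X: "square_integrable M (iterate k i)"
    using Suc by (intro square_integrable_iterate)
  show ?case
    unfolding local_var_Suc[abs_def]
    by (intro square_integrable_diff square_integrable_scaleR X square_integrable_error
        square_integrable_lipschitz[OF gradient_lipschitz] Suc)
qed

lemma iterate_square_integrable: "i < n \<Longrightarrow> square_integrable M (iterate k i)"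
  by (intro square_integrable_iterate square_integrable_local_var)

lemma error_square_integrable: "i < n \<Longrightarrow> square_integrable M (gradient_error k i)"
  by (intro square_integrable_error iterate_square_integrable)

lemma average_square_integrable: "square_integrable M (average k)"
  unfolding average_iterate[abs_def]
  by (intro square_integrable_sum square_integrable_scaleR iterate_square_integrable) auto

lemma mean_error_square_integrable: "square_integrable M (mean_error k)"
  unfolding mean_error_def[abs_def]
  by (intro square_integrable_sum square_integrable_scaleR error_square_integrable) auto

lemma gradient_deviation_square_integrable: "square_integrable M (gradient_deviation k)"
  unfolding gradient_deviation_def[abs_def]
  by (intro square_integrable_sum square_integrable_scaleR square_integrable_diff
      square_integrable_lipschitz[OF gradient_lipschitz] iterate_square_integrable
      average_square_integrable) auto

lemma mean_step_square_integrable: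
  "square_integrable M X \<Longrightarrow> square_integrable M (\<lambda>\<omega>. mean_step (X \<omega>))"
  by (rule square_integrable_lipschitz[OF mean_step_lipschitz])

lemma error_expectation_le:
  assumes "i < n"
  shows "expectation (\<lambda>\<omega>. (norm (gradient_error k i \<omega>))\<^sup>2) \<le> \<sigma>\<^sup>2"
  using gradient_error_expectation_le[OF stochastic_gradients[OF assms]
      square_integrable_measurable[OF iterate_square_integrable[OF assms], unfolded iterate_def[abs_def]]
      gradient_measurable[OF assms]]
  by (simp add: gradient_error_def iterate_def)

lemma error_orthogonal:
  assumes "i < n" and h: "C-lipschitz_on UNIV h"
  shows "expectation (\<lambda>\<omega>. h (iterate k i \<omega>) \<bullet> gradient_error k i \<omega>) = 0"
proof -
  have "continuous_on UNIV h"
    using h by (rule lipschitz_on_continuous_on)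
  then have "h \<in> borel_measurable borel"
    by (rule borel_measurable_continuous_onI)
  moreover note X = iterate_square_integrable[OF assms(1)]
  ultimately show ?thesis
    using gradient_error_orthogonal[OF stochastic_gradients[OF assms(1)]
        square_integrable_measurable[OF X, unfolded iterate_def[abs_def]] gradient_measurable[OF assms(1)],
        of h] square_integrable_lipschitz[OF h X] square_integrable_lipschitz[OF gradient_lipschitz[OF assms(1)] X]
    by (simp add: gradient_error_def iterate_def[abs_def])
qed

lemma local_contraction_factor:
  obtains c where "0 \<le> c" "c < 1"
    "\<And>i x y. i < n \<Longrightarrow> (norm ((x - \<alpha> *\<^sub>R gradient (f i) x) - (y - \<alpha> *\<^sub>R gradient (f i) y)))\<^sup>2 \<le>
      c * (norm (x - y))\<^sup>2"
proof -
  define \<rho> where "\<rho> i = 1 - 2 * \<alpha> * (\<mu> i * L i / (\<mu> i + L i))" for i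
  define c where "c = Max (\<rho> ` {..<n})"
  have ne: "{..<n} \<noteq> {}" using agents by (auto simp: lessThan_empty_iff)
  have \<rho>: "0 \<le> \<rho> i" "\<rho> i < 1" if "i < n" for i
    unfolding \<rho>_def
    using contraction_factor_bounds[OF \<mu>_pos[OF that] \<mu>_le_L[OF that] steplength_pos steplength_local[OF that]]
    by auto
  have le: "\<rho> i \<le> c" if "i < n" for i
    unfolding c_def using that by (intro Max_ge) auto
  show ?thesis
  proof (rule that)
    show "0 \<le> c" using \<rho>(1)[of 0] le[of 0] agents by simp
    show "c < 1" unfolding c_def using ne \<rho>(2) by (subst Max_less_iff) auto
    fix i x y assume i: "i < n"
    have "(norm ((x - \<alpha> *\<^sub>R gradient (f i) x) - (y - \<alpha> *\<^sub>R gradient (f i) y)))\<^sup>2 \<le> \<rho> i * (norm (x - y))\<^sup>2"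
      unfolding \<rho>_def
      by (rule gradient_step_contraction[OF objective_quadratic_bounds[OF i] \<mu>_pos[OF i] \<mu>_le_L[OF i]
            steplength_pos steplength_local[OF i]])
    also have "\<dots> \<le> c * (norm (x - y))\<^sup>2"
      using le[OF i] by (rule mult_right_mono) simp
    finally show "(norm ((x - \<alpha> *\<^sub>R gradient (f i) x) - (y - \<alpha> *\<^sub>R gradient (f i) y)))\<^sup>2 \<le>
        c * (norm (x - y))\<^sup>2" .
  qed
qed

text \<open>A small part of the local contraction is spent, through Young's inequality, on
  separating off the noise and the local gradients at \<open>u\<close>. The latter need not vanish,
  as the agents may have different minimizers, so this yields boundedness only.\<close>

lemma second_moment_bounded:
  obtains B where "\<And>k. expectation (\<lambda>\<omega>. \<Sum>i<n. (norm (local_var k i \<omega> - u))\<^sup>2) \<le> B"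
proof -
  obtain c where c: "0 \<le> c" "c < 1" and contr: "\<And>i x y. i < n \<Longrightarrow>
      (norm ((x - \<alpha> *\<^sub>R gradient (f i) x) - (y - \<alpha> *\<^sub>R gradient (f i) y)))\<^sup>2 \<le> c * (norm (x - y))\<^sup>2"
    using local_contraction_factor by metis
  \<comment> \<open>This weight leaves 1 - (1 + \<eta>) c = (1 - c) (2 - c) / 2, which is
    positive.\<close>
  define \<eta> where "\<eta> = (1 - c) / 2"
  have \<eta>: "\<eta> > 0" using c by (simp add: \<eta>_def)
  define q where "q = (1 + \<eta>) * c"
  have "0 < (1 - c) * (2 - c)" using c by simp
  then have "q < 1"
    by (simp add: q_def \<eta>_def field_simps)
  moreover have "0 \<le> q"
    using c \<eta> by (simp add: q_def)
  ultimately have q: "0 \<le> q" "q < 1" by auto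
  define K where "K = (1 + 1 / \<eta>) * (2 * \<alpha>\<^sup>2)"
  have K: "0 \<le> K" using \<eta> by (simp add: K_def)
  define D where "D = K * (\<Sum>i<n. (norm (gradient (f i) u))\<^sup>2 + \<sigma>\<^sup>2)"
  have D: "0 \<le> D" unfolding D_def using K by (intro mult_nonneg_nonneg sum_nonneg) auto
  define b where "b k = expectation (\<lambda>\<omega>. \<Sum>i<n. (norm (local_var k i \<omega> - u))\<^sup>2)" for k
  have int: "integrable M (\<lambda>\<omega>. (norm (local_var k i \<omega> - u))\<^sup>2)" if "i < n" for k i
    using that by (intro square_integrable_norm square_integrable_diff square_integrable_const
        square_integrable_local_var)
  have rec: "b (Suc k) \<le> q * b k + D" for k
  proof -
    have pt: "(\<Sum>i<n. (norm (local_var (Suc k) i \<omega> - u))\<^sup>2) \<le>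
        q * (\<Sum>i<n. (norm (local_var k i \<omega> - u))\<^sup>2) +
        K * (\<Sum>i<n. (norm (gradient (f i) u))\<^sup>2 + (norm (gradient_error k i \<omega>))\<^sup>2)" for \<omega>
    proof -
      have "(norm (local_var (Suc k) i \<omega> - u))\<^sup>2 \<le> q * (norm (iterate k i \<omega> - u))\<^sup>2 +
          K * ((norm (gradient (f i) u))\<^sup>2 + (norm (gradient_error k i \<omega>))\<^sup>2)" if i: "i < n" for i
      proof -
        define x where "x = iterate k i \<omega>"
        \<comment> \<open>\<open>v\<close> is the difference of the local gradient steps from
          \<open>x\<close> and from \<open>u\<close>, to which the contraction applies;
          \<open>w\<close> collects what the comparison point and the noise leave over.\<close>
        define v where "v = (x - \<alpha> *\<^sub>R gradient (f i) x) - (u - \<alpha> *\<^sub>R gradient (f i) u)"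
        define w where "w = - (\<alpha> *\<^sub>R (gradient (f i) u + gradient_error k i \<omega>))"
        have "local_var (Suc k) i \<omega> - u = v + w"
          by (simp add: local_var_Suc v_def w_def x_def algebra_simps)
        then have "(norm (local_var (Suc k) i \<omega> - u))\<^sup>2 \<le>
            (1 + \<eta>) * (norm v)\<^sup>2 + (1 + 1 / \<eta>) * (norm w)\<^sup>2"
          using norm_add_power2_le[OF \<eta>] by simp
        also have "\<dots> \<le> (1 + \<eta>) * (c * (norm (x - u))\<^sup>2) + (1 + 1 / \<eta>) *
            (\<alpha>\<^sup>2 * (2 * (norm (gradient (f i) u))\<^sup>2 + 2 * (norm (gradient_error k i \<omega>))\<^sup>2))"
        proof (intro add_mono mult_left_mono)
          show "(norm v)\<^sup>2 \<le> c * (norm (x - u))\<^sup>2"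
            unfolding v_def by (rule contr[OF i])
          show "(norm w)\<^sup>2 \<le>
              \<alpha>\<^sup>2 * (2 * (norm (gradient (f i) u))\<^sup>2 + 2 * (norm (gradient_error k i \<omega>))\<^sup>2)"
            unfolding w_def norm_minus_cancel norm_scaleR power_mult_distrib power2_abs
            by (intro mult_left_mono norm_add_power2_le_double) auto
        qed (use \<eta> in auto)
        finally show ?thesis
          by (simp add: q_def K_def x_def algebra_simps)
      qed
      then have "(\<Sum>i<n. (norm (local_var (Suc k) i \<omega> - u))\<^sup>2) \<le>
          (\<Sum>i<n. q * (norm (iterate k i \<omega> - u))\<^sup>2 +
            K * ((norm (gradient (f i) u))\<^sup>2 + (norm (gradient_error k i \<omega>))\<^sup>2))"
        by (intro sum_mono) auto
      also have "\<dots> = q * (\<Sum>i<n. (norm (iterate k i \<omega> - u))\<^sup>2) +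
          K * (\<Sum>i<n. (norm (gradient (f i) u))\<^sup>2 + (norm (gradient_error k i \<omega>))\<^sup>2)"
        by (simp add: sum.distrib sum_distrib_left distrib_left)
      \<comment> \<open>Mixing is nonexpansive only for the sum over agents, which is why the
        recursion runs on that sum.\<close>
      also have "(\<Sum>i<n. (norm (iterate k i \<omega> - u))\<^sup>2) \<le> (\<Sum>i<n. (norm (local_var k i \<omega> - u))\<^sup>2)"
        using consensus_pow_sum_norm_power2_le[OF consensus, of k "\<lambda>j. local_var k j \<omega> - u"]
        by (simp add: consensus_pow_diff_const[OF consensus] iterate_eq)
      finally show ?thesis
        using q by (simp add: mult_left_mono)
    qed
    have inte: "integrable M (\<lambda>\<omega>. (norm (gradient_error k i \<omega>))\<^sup>2)" if "i < n" for i
      using that by (intro square_integrable_norm error_square_integrable)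
    have ints: "integrable M (\<lambda>\<omega>. \<Sum>i<n. (norm (local_var k i \<omega> - u))\<^sup>2)" for k
      using int by (intro Bochner_Integration.integrable_sum) auto
    have intes: "integrable M (\<lambda>\<omega>. \<Sum>i<n. (norm (gradient (f i) u))\<^sup>2 + (norm (gradient_error k i \<omega>))\<^sup>2)"
      using inte by (intro Bochner_Integration.integrable_sum Bochner_Integration.integrable_add) auto
    have "b (Suc k) \<le> expectation (\<lambda>\<omega>. q * (\<Sum>i<n. (norm (local_var k i \<omega> - u))\<^sup>2) +
        K * (\<Sum>i<n. (norm (gradient (f i) u))\<^sup>2 + (norm (gradient_error k i \<omega>))\<^sup>2))"
      unfolding b_def
      by (intro integral_mono pt Bochner_Integration.integrable_add integrable_mult_right ints intes)
    also have "\<dots> = q * b k + K *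
        expectation (\<lambda>\<omega>. \<Sum>i<n. (norm (gradient (f i) u))\<^sup>2 + (norm (gradient_error k i \<omega>))\<^sup>2)"
      unfolding b_def
      by (subst Bochner_Integration.integral_add)
        (simp_all only: integrable_mult_right ints intes integral_mult_right_zero)
    also have "expectation (\<lambda>\<omega>. \<Sum>i<n. (norm (gradient (f i) u))\<^sup>2 + (norm (gradient_error k i \<omega>))\<^sup>2) =
        (\<Sum>i<n. (norm (gradient (f i) u))\<^sup>2 + expectation (\<lambda>\<omega>. (norm (gradient_error k i \<omega>))\<^sup>2))"
      using inte by (simp add: Bochner_Integration.integral_sum prob_space)
    also have "q * b k + K * \<dots> \<le> q * b k + D"
      unfolding D_def using K
      by (intro add_left_mono mult_left_mono sum_mono error_expectation_le) auto
    finally show ?thesis .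
  qed
  have "0 \<le> b 0" by (simp add: b_def sum_nonneg)
  from recursion_bounded[where b = b, OF rec q D this] show ?thesis
    unfolding b_def by (rule that)
qed

section \<open>Decay of the consensus error\<close>

definition consensus_error where
  "consensus_error k = expectation (\<lambda>\<omega>. \<Sum>i<n. (norm (iterate k i \<omega> - average k \<omega>))\<^sup>2)"

lemma integrable_consensus_error:
  "i < n \<Longrightarrow> integrable M (\<lambda>\<omega>. (norm (iterate k i \<omega> - average k \<omega>))\<^sup>2)"
  by (intro square_integrable_norm square_integrable_diff iterate_square_integrable
      average_square_integrable)

lemma integrable_consensus_error_sum:
  "integrable M (\<lambda>\<omega>. \<Sum>i<n. (norm (iterate k i \<omega> - average k \<omega>))\<^sup>2)"
  by (intro Bochner_Integration.integrable_sum integrable_consensus_error) auto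

lemma consensus_error_nonneg: "0 \<le> consensus_error k"
  by (simp add: consensus_error_def sum_nonneg)

text \<open>The deviations from the average are \<open>k\<close> rounds of consensus applied to the
  centered local variables. The mixing factor \<open>r k\<close> multiplies a second moment bounded
  uniformly in \<open>k\<close>, and it tends to zero because the number of rounds grows with the
  iteration.\<close>

lemma consensus_error_tendsto_0: "consensus_error \<longlonglongrightarrow> 0"
proof -
  obtain B where B: "\<And>k. expectation (\<lambda>\<omega>. \<Sum>i<n. (norm (local_var k i \<omega> - 0))\<^sup>2) \<le> B"
    using second_moment_bounded[of 0] by metis
  obtain r :: "nat \<Rightarrow> real" where r: "r \<longlonglongrightarrow> 0" "\<And>k. 0 \<le> r k"
    and mix: "\<And>k (v :: nat \<Rightarrow> real^'p) i. (\<Sum>j<n. v j) = 0 \<Longrightarrow> i < n \<Longrightarrow>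
      (norm ((consensus n W ^^ k) v i))\<^sup>2 \<le> r k * (\<Sum>j<n. (norm (v j))\<^sup>2)"
    using consensus_mixing[OF consensus network agents] by metis
  have "consensus_error k \<le> real n * (r k * B)" for k
  proof -
    have pt: "(\<Sum>i<n. (norm (iterate k i \<omega> - average k \<omega>))\<^sup>2) \<le>
        real n * (r k * (\<Sum>i<n. (norm (local_var k i \<omega> - 0))\<^sup>2))" for \<omega>
    proof -
      let ?v = "\<lambda>j. local_var k j \<omega> - average k \<omega>"
      have zero: "(\<Sum>j<n. ?v j) = 0"
        using agents by (simp add: average_local_var sum_subtractf sum_constant_scaleR del: sum_constant)
      have var: "(\<Sum>j<n. (norm (?v j))\<^sup>2) \<le> (\<Sum>i<n. (norm (local_var k i \<omega> - 0))\<^sup>2)"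
        unfolding average_local_var by (rule sum_norm_diff_mean_le[OF agents])
      have "(norm (iterate k i \<omega> - average k \<omega>))\<^sup>2 \<le>
          r k * (\<Sum>i<n. (norm (local_var k i \<omega> - 0))\<^sup>2)" if i: "i < n" for i
      proof -
        have "iterate k i \<omega> - average k \<omega> = (consensus n W ^^ k) ?v i"
          using i by (simp add: consensus_pow_diff_const[OF consensus] iterate_eq)
        then show ?thesis
          using mix[OF zero i, of k] mult_left_mono[OF var r(2), of k] by simp
      qed
      then show ?thesis
        using sum_bounded_above[of "{..<n}" "\<lambda>i. (norm (iterate k i \<omega> - average k \<omega>))\<^sup>2"] by simp
    qed
    have int: "integrable M (\<lambda>\<omega>. \<Sum>i<n. (norm (local_var k i \<omega> - 0))\<^sup>2)"
      by (intro Bochner_Integration.integrable_sum square_integrable_norm square_integrable_diff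
          square_integrable_const square_integrable_local_var) auto
    have "consensus_error k \<le>
        expectation (\<lambda>\<omega>. real n * (r k * (\<Sum>i<n. (norm (local_var k i \<omega> - 0))\<^sup>2)))"
      unfolding consensus_error_def
      by (intro integral_mono pt integrable_consensus_error_sum integrable_mult_right int)
    also have "\<dots> = real n * (r k * expectation (\<lambda>\<omega>. \<Sum>i<n. (norm (local_var k i \<omega> - 0))\<^sup>2))"
      by (simp only: integral_mult_right_zero)
    also have "\<dots> \<le> real n * (r k * B)"
      using r(2) B by (intro mult_left_mono) auto
    finally show ?thesis .
  qed
  then have le: "\<forall>\<^sub>F k in sequentially. consensus_error k \<le> real n * (r k * B)"
    by simp
  have "(\<lambda>k. real n * (r k * B)) \<longlonglongrightarrow> 0"
    using r(1) by (intro tendsto_mult_right_zero tendsto_mult_left_zero)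
  then show ?thesis
    by (rule tendsto_sandwich[OF _ le tendsto_const, rotated]) (simp add: consensus_error_nonneg)
qed

subsection \<open>The mean square error\<close>

definition mean_square_error where
  "mean_square_error k = expectation (\<lambda>\<omega>. (norm (average k \<omega> - minimizer n f))\<^sup>2)"

text \<open>A crude common bound for all squared smoothness constants. It multiplies only terms that
  vanish with the consensus error, so its size does not affect the limiting neighborhood.\<close>

definition smoothness_sum where
  "smoothness_sum = (\<Sum>i<n. (L i)\<^sup>2)"

lemma smoothness_sum_nonneg: "0 \<le> smoothness_sum"
  by (simp add: smoothness_sum_def sum_nonneg)

lemma gradient_deviation_le:
  "(norm (gradient_deviation k \<omega>))\<^sup>2 \<le>
    smoothness_sum * (\<Sum>i<n. (norm (iterate k i \<omega> - average k \<omega>))\<^sup>2)"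
proof -
  let ?d = "\<lambda>i. gradient (f i) (iterate k i \<omega>) - gradient (f i) (average k \<omega>)"
  have "(norm (gradient_deviation k \<omega>))\<^sup>2 \<le> (\<Sum>i<n. (1 / real n) * (norm (?d i))\<^sup>2)"
    unfolding gradient_deviation_def using agents
    by (intro norm_convex_combination_power2) auto
  also have "\<dots> \<le> (\<Sum>i<n. 1 * (smoothness_sum * (norm (iterate k i \<omega> - average k \<omega>))\<^sup>2))"
  proof (intro sum_mono mult_mono)
    fix i assume "i \<in> {..<n}"
    then have i: "i < n" by simp
    have "(norm (?d i))\<^sup>2 \<le> (L i * norm (iterate k i \<omega> - average k \<omega>))\<^sup>2"
      using lipschitz_onD[OF gradient_lipschitz[OF i], of "iterate k i \<omega>" "average k \<omega>"]
      by (intro power_mono) (auto simp: dist_norm)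
    also have "\<dots> = (L i)\<^sup>2 * (norm (iterate k i \<omega> - average k \<omega>))\<^sup>2"
      by (simp add: power_mult_distrib)
    also have "\<dots> \<le> smoothness_sum * (norm (iterate k i \<omega> - average k \<omega>))\<^sup>2"
      unfolding smoothness_sum_def using i
      by (intro mult_right_mono member_le_sum[of i "{..<n}" "\<lambda>i. (L i)\<^sup>2"]) auto
    finally show "(norm (?d i))\<^sup>2 \<le> smoothness_sum * (norm (iterate k i \<omega> - average k \<omega>))\<^sup>2" .
  qed (use agents in auto)
  finally show ?thesis
    by (simp add: sum_distrib_left)
qed

text \<open>
  The error of agent \<open>i\<close> is orthogonal only to functions of agent \<open>i\<close>'s own iterate, so the
  direction of the mean gradient step is compared with the step taken from that iterate; the
  difference is controlled by the consensus error.
\<close>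

lemma mean_error_cross_term:
  "\<bar>expectation (\<lambda>\<omega>. (mean_step (average k \<omega>) - minimizer n f - \<alpha> *\<^sub>R gradient_deviation k \<omega>) \<bullet>
      mean_error k \<omega>)\<bar> \<le> sqrt ((2 + 2 * \<alpha>\<^sup>2 * smoothness_sum) * consensus_error k * \<sigma>\<^sup>2)"
proof -
  define U where "U \<omega> = mean_step (average k \<omega>) - minimizer n f - \<alpha> *\<^sub>R gradient_deviation k \<omega>" for \<omega>
  define s where "s = sqrt ((2 + 2 * \<alpha>\<^sup>2 * smoothness_sum) * consensus_error k * \<sigma>\<^sup>2)"
  have U: "square_integrable M U"
    unfolding U_def[abs_def]
    by (intro square_integrable_diff square_integrable_scaleR mean_step_square_integrable
        average_square_integrable gradient_deviation_square_integrable square_integrable_const)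
  have le: "\<bar>expectation (\<lambda>\<omega>. U \<omega> \<bullet> gradient_error k i \<omega>)\<bar> \<le> s" if i: "i < n" for i
  proof -
    define V where "V \<omega> = mean_step (iterate k i \<omega>) - minimizer n f" for \<omega>
    have V: "square_integrable M V"
      unfolding V_def[abs_def] using i
      by (intro square_integrable_diff mean_step_square_integrable iterate_square_integrable
          square_integrable_const)
    have UV: "square_integrable M (\<lambda>\<omega>. U \<omega> - V \<omega>)"
      using U V by (rule square_integrable_diff)
    note e = error_square_integrable[OF i, of k]
    have lip: "1-lipschitz_on UNIV (\<lambda>x. mean_step x - minimizer n f)"
      using mean_step_lipschitz by (auto simp: lipschitz_on_def dist_norm)
    have "expectation (\<lambda>\<omega>. U \<omega> \<bullet> gradient_error k i \<omega>) =
        expectation (\<lambda>\<omega>. (U \<omega> - V \<omega>) \<bullet> gradient_error k i \<omega> + V \<omega> \<bullet> gradient_error k i \<omega>)"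
      by (simp add: inner_diff_left)
    also have "\<dots> = expectation (\<lambda>\<omega>. (U \<omega> - V \<omega>) \<bullet> gradient_error k i \<omega>) +
        expectation (\<lambda>\<omega>. V \<omega> \<bullet> gradient_error k i \<omega>)"
      by (intro Bochner_Integration.integral_add square_integrable_inner UV V e)
    also have "expectation (\<lambda>\<omega>. V \<omega> \<bullet> gradient_error k i \<omega>) = 0"
      unfolding V_def by (rule error_orthogonal[OF i lip])
    finally have "\<bar>expectation (\<lambda>\<omega>. U \<omega> \<bullet> gradient_error k i \<omega>)\<bar> \<le>
        sqrt (expectation (\<lambda>\<omega>. (norm (U \<omega> - V \<omega>))\<^sup>2) * expectation (\<lambda>\<omega>. (norm (gradient_error k i \<omega>))\<^sup>2))"
      using expectation_Cauchy_Schwarz[OF UV e] by simp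
    also have "\<dots> \<le> s"
      unfolding s_def
    proof (intro real_sqrt_le_mono mult_mono error_expectation_le i)
      \<comment> \<open>One 2 comes from the mean steps, which are 1-Lipschitz, the other from the
        gradient deviation scaled by \<alpha>.\<close>
      have pt: "(norm (U \<omega> - V \<omega>))\<^sup>2 \<le> (2 + 2 * \<alpha>\<^sup>2 * smoothness_sum) *
          (\<Sum>i<n. (norm (iterate k i \<omega> - average k \<omega>))\<^sup>2)" (is "_ \<le> _ * ?S") for \<omega>
      proof -
        have "(norm (mean_step (average k \<omega>) - mean_step (iterate k i \<omega>)))\<^sup>2 \<le>
            (norm (iterate k i \<omega> - average k \<omega>))\<^sup>2"
          using lipschitz_onD[OF mean_step_lipschitz, of "average k \<omega>" "iterate k i \<omega>"]
          by (intro power_mono) (auto simp: dist_norm norm_minus_commute)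
        also have "\<dots> \<le> ?S"
          using i by (intro member_le_sum[of i "{..<n}" "\<lambda>i. (norm (iterate k i \<omega> - average k \<omega>))\<^sup>2"]) auto
        finally have 1: "(norm (mean_step (average k \<omega>) - mean_step (iterate k i \<omega>)))\<^sup>2 \<le> ?S" .
        have 2: "(norm (\<alpha> *\<^sub>R gradient_deviation k \<omega>))\<^sup>2 \<le> \<alpha>\<^sup>2 * (smoothness_sum * ?S)"
          using mult_left_mono[OF gradient_deviation_le, of "\<alpha>\<^sup>2"] by (simp add: power_mult_distrib)
        have "U \<omega> - V \<omega> = (mean_step (average k \<omega>) - mean_step (iterate k i \<omega>)) -
            \<alpha> *\<^sub>R gradient_deviation k \<omega>"
          by (simp add: U_def V_def)
        then have "(norm (U \<omega> - V \<omega>))\<^sup>2 \<le>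
            2 * (norm (mean_step (average k \<omega>) - mean_step (iterate k i \<omega>)))\<^sup>2 +
            2 * (norm (\<alpha> *\<^sub>R gradient_deviation k \<omega>))\<^sup>2"
          by (metis norm_diff_power2_le_double)
        also have "\<dots> \<le> 2 * ?S + 2 * (\<alpha>\<^sup>2 * (smoothness_sum * ?S))"
          using 1 2 by linarith
        finally show ?thesis
          by (simp add: algebra_simps)
      qed
      have "expectation (\<lambda>\<omega>. (norm (U \<omega> - V \<omega>))\<^sup>2) \<le> expectation (\<lambda>\<omega>. (2 + 2 * \<alpha>\<^sup>2 * smoothness_sum) *
          (\<Sum>i<n. (norm (iterate k i \<omega> - average k \<omega>))\<^sup>2))"
        by (intro integral_mono pt square_integrable_norm[OF UV] integrable_mult_right
            integrable_consensus_error_sum)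
      then show "expectation (\<lambda>\<omega>. (norm (U \<omega> - V \<omega>))\<^sup>2) \<le>
          (2 + 2 * \<alpha>\<^sup>2 * smoothness_sum) * consensus_error k"
        by (simp only: integral_mult_right_zero consensus_error_def)
    qed (auto intro!: mult_nonneg_nonneg add_nonneg_nonneg simp: consensus_error_nonneg smoothness_sum_nonneg)
    finally show ?thesis .
  qed
  have "expectation (\<lambda>\<omega>. U \<omega> \<bullet> mean_error k \<omega>) =
      expectation (\<lambda>\<omega>. \<Sum>i<n. (1 / real n) * (U \<omega> \<bullet> gradient_error k i \<omega>))"
    by (simp add: mean_error_def inner_sum_right)
  also have "\<dots> = (\<Sum>i<n. (1 / real n) * expectation (\<lambda>\<omega>. U \<omega> \<bullet> gradient_error k i \<omega>))"
    by (subst Bochner_Integration.integral_sum)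
      (auto intro!: integrable_mult_right square_integrable_inner U error_square_integrable
        simp del: times_divide_eq_left mult_1 integrable_mult_right_iff)
  also have "\<bar>\<dots>\<bar> \<le> (\<Sum>i<n. (1 / real n) * s)"
    using le by (intro order_trans[OF sum_abs] sum_mono) (auto simp: abs_mult divide_right_mono)
  also have "\<dots> = s"
    using agents by simp
  finally show ?thesis
    by (simp add: U_def s_def)
qed

text \<open>The Young penalty for the gradient deviation, plus the bound on the cross term of the
  expanded square.\<close>

definition recursion_remainder where
  "recursion_remainder \<psi> k = (1 + 1 / \<psi>) * (\<alpha>\<^sup>2 * (smoothness_sum * consensus_error k)) +
    2 * \<alpha> * sqrt ((2 + 2 * \<alpha>\<^sup>2 * smoothness_sum) * consensus_error k * \<sigma>\<^sup>2)"

lemma recursion_remainder_tendsto_0: "recursion_remainder \<psi> \<longlonglongrightarrow> 0"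
proof -
  have "(\<lambda>k. (1 + 1 / \<psi>) * (\<alpha>\<^sup>2 * (smoothness_sum * consensus_error k)) +
      2 * \<alpha> * sqrt ((2 + 2 * \<alpha>\<^sup>2 * smoothness_sum) * consensus_error k * \<sigma>\<^sup>2)) \<longlonglongrightarrow>
      (1 + 1 / \<psi>) * (\<alpha>\<^sup>2 * (smoothness_sum * 0)) +
      2 * \<alpha> * sqrt ((2 + 2 * \<alpha>\<^sup>2 * smoothness_sum) * 0 * \<sigma>\<^sup>2)"
    by (intro tendsto_intros consensus_error_tendsto_0)
  then show ?thesis
    by (simp add: recursion_remainder_def[abs_def])
qed

text \<open>The minimizer is a fixed point of the mean step, so the mean step contracts towards it;
  the weight \<psi> then splits off the deviation. The noise is subtracted afterwards by an exact
  expansion. \<open>V\<close> is left open to accommodate both variance bounds.\<close>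

lemma mean_square_error_Suc:
  assumes "\<psi> > 0" and V: "expectation (\<lambda>\<omega>. (norm (mean_error k \<omega>))\<^sup>2) \<le> V"
  shows "mean_square_error (Suc k) \<le>
    c1 n \<mu> L \<alpha> \<psi> * mean_square_error k + \<alpha>\<^sup>2 * V + recursion_remainder \<psi> k"
proof -
  let ?x = "minimizer n f"
  define U where "U \<omega> = mean_step (average k \<omega>) - ?x - \<alpha> *\<^sub>R gradient_deviation k \<omega>" for \<omega>
  have U: "square_integrable M U"
    unfolding U_def[abs_def]
    by (intro square_integrable_diff square_integrable_scaleR mean_step_square_integrable
        average_square_integrable gradient_deviation_square_integrable square_integrable_const)
  have avg: "integrable M (\<lambda>\<omega>. (norm (average k \<omega> - ?x))\<^sup>2)"
    by (intro square_integrable_norm square_integrable_diff average_square_integrable square_integrable_const)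
  let ?S = "\<lambda>\<omega>. \<Sum>i<n. (norm (iterate k i \<omega> - average k \<omega>))\<^sup>2"
  have pt: "(norm (U \<omega>))\<^sup>2 \<le> c1 n \<mu> L \<alpha> \<psi> * (norm (average k \<omega> - ?x))\<^sup>2 +
      (1 + 1 / \<psi>) * (\<alpha>\<^sup>2 * (smoothness_sum * ?S \<omega>))" for \<omega>
  proof -
    have "(norm (U \<omega>))\<^sup>2 \<le> (1 + \<psi>) * (norm (mean_step (average k \<omega>) - mean_step ?x))\<^sup>2 +
        (1 + 1 / \<psi>) * (norm (- (\<alpha> *\<^sub>R gradient_deviation k \<omega>)))\<^sup>2"
      using norm_add_power2_le[OF assms(1), of "mean_step (average k \<omega>) - ?x" "- (\<alpha> *\<^sub>R gradient_deviation k \<omega>)"]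
      by (simp add: U_def mean_step_minimizer)
    also have "\<dots> \<le> (1 + \<psi>) * (contraction * (norm (average k \<omega> - ?x))\<^sup>2) +
        (1 + 1 / \<psi>) * (\<alpha>\<^sup>2 * (smoothness_sum * ?S \<omega>))"
    proof (intro add_mono mult_left_mono mean_step_contraction)
      show "(norm (- (\<alpha> *\<^sub>R gradient_deviation k \<omega>)))\<^sup>2 \<le> \<alpha>\<^sup>2 * (smoothness_sum * ?S \<omega>)"
        unfolding norm_minus_cancel norm_scaleR power_mult_distrib power2_abs
        by (intro mult_left_mono gradient_deviation_le) auto
    qed (use assms(1) in auto)
    finally show ?thesis
      by (simp add: c1_def contraction_def mult.assoc)
  qed
  have "expectation (\<lambda>\<omega>. (norm (U \<omega>))\<^sup>2) \<le>
      expectation (\<lambda>\<omega>. c1 n \<mu> L \<alpha> \<psi> * (norm (average k \<omega> - ?x))\<^sup>2 +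
        (1 + 1 / \<psi>) * (\<alpha>\<^sup>2 * (smoothness_sum * ?S \<omega>)))"
    by (intro integral_mono pt square_integrable_norm[OF U] Bochner_Integration.integrable_add
        integrable_mult_right avg integrable_consensus_error_sum)
  also have "\<dots> = c1 n \<mu> L \<alpha> \<psi> * mean_square_error k +
      (1 + 1 / \<psi>) * (\<alpha>\<^sup>2 * (smoothness_sum * consensus_error k))"
    by (subst Bochner_Integration.integral_add)
      (auto intro!: integrable_mult_right avg integrable_consensus_error_sum
        simp: mean_square_error_def consensus_error_def simp del: integrable_mult_right_iff)
  finally have bound_U: "expectation (\<lambda>\<omega>. (norm (U \<omega>))\<^sup>2) \<le> \<dots>" .
  have "mean_square_error (Suc k) = expectation (\<lambda>\<omega>. (norm (U \<omega> - \<alpha> *\<^sub>R mean_error k \<omega>))\<^sup>2)"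
    by (simp add: mean_square_error_def average_Suc U_def algebra_simps)
  also have "\<dots> = expectation (\<lambda>\<omega>. (norm (U \<omega>))\<^sup>2) - 2 * \<alpha> * expectation (\<lambda>\<omega>. U \<omega> \<bullet> mean_error k \<omega>) +
      \<alpha>\<^sup>2 * expectation (\<lambda>\<omega>. (norm (mean_error k \<omega>))\<^sup>2)"
    by (rule expectation_norm_diff_power2[OF U mean_error_square_integrable])
  also have "\<dots> \<le> (c1 n \<mu> L \<alpha> \<psi> * mean_square_error k +
      (1 + 1 / \<psi>) * (\<alpha>\<^sup>2 * (smoothness_sum * consensus_error k))) +
      2 * \<alpha> * sqrt ((2 + 2 * \<alpha>\<^sup>2 * smoothness_sum) * consensus_error k * \<sigma>\<^sup>2) + \<alpha>\<^sup>2 * V"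
  proof -
    have "- expectation (\<lambda>\<omega>. U \<omega> \<bullet> mean_error k \<omega>) \<le>
        sqrt ((2 + 2 * \<alpha>\<^sup>2 * smoothness_sum) * consensus_error k * \<sigma>\<^sup>2)"
      using mean_error_cross_term[of k] by (simp add: U_def abs_le_iff)
    then have "2 * \<alpha> * (- expectation (\<lambda>\<omega>. U \<omega> \<bullet> mean_error k \<omega>)) \<le>
        2 * \<alpha> * sqrt ((2 + 2 * \<alpha>\<^sup>2 * smoothness_sum) * consensus_error k * \<sigma>\<^sup>2)"
      using steplength_pos by (intro mult_left_mono) auto
    moreover have "\<alpha>\<^sup>2 * expectation (\<lambda>\<omega>. (norm (mean_error k \<omega>))\<^sup>2) \<le> \<alpha>\<^sup>2 * V"
      using V by (rule mult_left_mono) simp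
    ultimately show ?thesis
      using bound_U by linarith
  qed
  finally show ?thesis
    by (simp add: recursion_remainder_def)
qed

text \<open>The upper bound on \<psi> is the inequality \<open>c1 < 1\<close> solved for \<psi>. If
  the contraction factor is zero there is nothing to solve, and \<open>c1\<close> is zero.\<close>

lemma c1_bounds:
  assumes "admissible_psi n \<mu> L \<alpha> \<psi>"
  shows "0 \<le> c1 n \<mu> L \<alpha> \<psi>" and "c1 n \<mu> L \<alpha> \<psi> < 1"
proof -
  have \<psi>: "\<psi> > 0" using assms by (simp add: admissible_psi_def)
  have c1: "c1 n \<mu> L \<alpha> \<psi> = (1 + \<psi>) * contraction"
    by (simp add: c1_def contraction_def)
  show "0 \<le> c1 n \<mu> L \<alpha> \<psi>"
    unfolding c1 using \<psi> contraction_nonneg by simp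
  show "c1 n \<mu> L \<alpha> \<psi> < 1"
  proof (cases "contraction = 0")
    case False
    then have "\<psi> < (1 - contraction) / contraction"
      using assms by (simp add: admissible_psi_def contraction_def)
    moreover have "contraction > 0" using False contraction_nonneg by simp
    ultimately have "\<psi> * contraction < 1 - contraction"
      by (simp add: pos_less_divide_eq)
    then show ?thesis
      unfolding c1 by (simp add: algebra_simps)
  qed (simp add: c1)
qed

lemma limit_mean_square_error_le:
  assumes psi: "admissible_psi n \<mu> L \<alpha> \<psi>"
    and V: "\<And>k. expectation (\<lambda>\<omega>. (norm (mean_error k \<omega>))\<^sup>2) \<le> V"
  shows "limit_mean_square_error M n W f g \<xi> \<alpha> y0 \<le> ennreal (\<alpha>\<^sup>2 * V / (1 - c1 n \<mu> L \<alpha> \<psi>))"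
proof -
  have "0 \<le> expectation (\<lambda>\<omega>. (norm (mean_error 0 \<omega>))\<^sup>2)"
    by simp
  then have "0 \<le> V" using V[of 0] by linarith
  \<comment> \<open>Integrability identifies the extended integral in the goal with the real
    expectation of the recursion.\<close>
  have "integrable M (\<lambda>\<omega>. (norm (average k \<omega> - minimizer n f))\<^sup>2)" for k
    by (intro square_integrable_norm square_integrable_diff average_square_integrable square_integrable_const)
  then have "limit_mean_square_error M n W f g \<xi> \<alpha> y0 = limsup (\<lambda>k. ennreal (mean_square_error k))"
    unfolding limit_mean_square_error_def mean_square_error_def
    by (simp add: nn_integral_eq_integral average_def)
  also have "\<dots> \<le> ennreal (\<alpha>\<^sup>2 * V / (1 - c1 n \<mu> L \<alpha> \<psi>))"
  proof (rule recursion_limsup_le)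
    show "mean_square_error (Suc k) \<le>
        c1 n \<mu> L \<alpha> \<psi> * mean_square_error k + \<alpha>\<^sup>2 * V + recursion_remainder \<psi> k" for k
      using psi V by (intro mean_square_error_Suc) (auto simp: admissible_psi_def)
  qed (use c1_bounds[OF psi] recursion_remainder_tendsto_0 \<open>0 \<le> V\<close> in auto)
  finally show ?thesis .
qed

text \<open>Convexity of the squared norm alone. Nothing is known here about correlations, and
  agents with identical errors would gain nothing from averaging.\<close>

lemma mean_error_variance: "expectation (\<lambda>\<omega>. (norm (mean_error k \<omega>))\<^sup>2) \<le> \<sigma>\<^sup>2"
proof -
  have int: "integrable M (\<lambda>\<omega>. (norm (gradient_error k i \<omega>))\<^sup>2)" if "i < n" for i
    using that by (intro square_integrable_norm error_square_integrable)
  have "expectation (\<lambda>\<omega>. (norm (mean_error k \<omega>))\<^sup>2) \<le>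
      expectation (\<lambda>\<omega>. \<Sum>i<n. (1 / real n) * (norm (gradient_error k i \<omega>))\<^sup>2)"
  proof (intro integral_mono square_integrable_norm mean_error_square_integrable
      Bochner_Integration.integrable_sum integrable_mult_right int)
    show "(norm (mean_error k \<omega>))\<^sup>2 \<le> (\<Sum>i<n. (1 / real n) * (norm (gradient_error k i \<omega>))\<^sup>2)" for \<omega>
      unfolding mean_error_def using agents by (intro norm_convex_combination_power2) auto
  qed (simp add: error_square_integrable)
  also have "\<dots> = (\<Sum>i<n. (1 / real n) * expectation (\<lambda>\<omega>. (norm (gradient_error k i \<omega>))\<^sup>2))"
    using int by (simp add: Bochner_Integration.integral_sum)
  also have "\<dots> \<le> (\<Sum>i<n. (1 / real n) * \<sigma>\<^sup>2)"
    by (intro sum_mono mult_left_mono error_expectation_le) auto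
  also have "\<dots> = \<sigma>\<^sup>2"
    using agents by simp
  finally show ?thesis .
qed

text \<open>Of the double sum only the \<open>n\<close> diagonal terms remain, against a prefactor
  of 1/n squared.\<close>

lemma mean_error_variance_uncorrelated:
  assumes "uncorrelated_errors M n W f g \<xi> \<alpha> y0"
  shows "expectation (\<lambda>\<omega>. (norm (mean_error k \<omega>))\<^sup>2) \<le> \<sigma>\<^sup>2 / real n"
proof -
  have orth: "expectation (\<lambda>\<omega>. gradient_error k i \<omega> \<bullet> gradient_error k j \<omega>) = 0"
    if "i < n" "j < n" "i \<noteq> j" for i j
    using assms that by (simp add: uncorrelated_errors_def Let_def gradient_error_def iterate_def)
  have int: "integrable M (\<lambda>\<omega>. gradient_error k i \<omega> \<bullet> gradient_error k j \<omega>)" if "i < n" "j < n" for i j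
    using that by (intro square_integrable_inner error_square_integrable)
  have "expectation (\<lambda>\<omega>. (norm (mean_error k \<omega>))\<^sup>2) =
      expectation (\<lambda>\<omega>. (1 / real n)\<^sup>2 * (\<Sum>i<n. \<Sum>j<n. gradient_error k i \<omega> \<bullet> gradient_error k j \<omega>))"
    unfolding mean_error_def scaleR_sum_right[symmetric] norm_scaleR power_mult_distrib
    unfolding power2_norm_eq_inner inner_sum_left
    unfolding inner_sum_right by simp
  also have "\<dots> = (1 / real n)\<^sup>2 * (\<Sum>i<n. \<Sum>j<n. expectation (\<lambda>\<omega>. gradient_error k i \<omega> \<bullet> gradient_error k j \<omega>))"
    unfolding integral_mult_right_zero using int
    by (subst Bochner_Integration.integral_sum)
      (auto intro!: sum.cong Bochner_Integration.integral_sum Bochner_Integration.integrable_sum)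
  also have "\<dots> = (1 / real n)\<^sup>2 * (\<Sum>i<n. \<Sum>j<n. if j = i then expectation (\<lambda>\<omega>. (norm (gradient_error k i \<omega>))\<^sup>2) else 0)"
    using orth by (intro arg_cong2[of _ _ _ _ "(*)"] sum.cong refl) (auto simp: power2_norm_eq_inner)
  also have "\<dots> = (1 / real n)\<^sup>2 * (\<Sum>i<n. expectation (\<lambda>\<omega>. (norm (gradient_error k i \<omega>))\<^sup>2))"
    by simp
  also have "\<dots> \<le> (1 / real n)\<^sup>2 * (\<Sum>i<n. \<sigma>\<^sup>2)"
    by (intro mult_left_mono sum_mono error_expectation_le) auto
  also have "\<dots> = \<sigma>\<^sup>2 / real n"
    using agents by (simp add: power2_eq_square)
  finally show ?thesis .
qed

end

text \<open>The position of \<open>C\<close> among the quantifiers carries the content. In the first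
  conjunct it precedes \<open>n\<close>, so the decay in 1/n is genuine; in the second it follows
  \<open>n\<close> and may compensate for that factor, while still being uniform in all other
  data.\<close>

theorem mainTheorem2:
  shows
    "(\<exists>C>0. \<forall>(M :: 'w measure) n E W (f :: nat \<Rightarrow> real^'p \<Rightarrow> real) \<mu> L
        (g :: nat \<Rightarrow> real^'p \<Rightarrow> 'd::euclidean_space \<Rightarrow> real^'p) \<xi> \<sigma> \<alpha> y0 \<psi>.
        stochastic_near_dgd M n E W f \<mu> L g \<xi> \<sigma> \<alpha> y0 \<longrightarrow>
        uncorrelated_errors M n W f g \<xi> \<alpha> y0 \<longrightarrow>
        admissible_psi n \<mu> L \<alpha> \<psi> \<longrightarrow>
        limit_mean_square_error M n W f g \<xi> \<alpha> y0 \<le>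
          ennreal (C * (\<alpha>\<^sup>2 * \<sigma>\<^sup>2 / (real n * (1 - c1 n \<mu> L \<alpha> \<psi>))))) \<and>
     (\<forall>n. \<exists>C>0. \<forall>(M :: 'w measure) E W (f :: nat \<Rightarrow> real^'p \<Rightarrow> real) \<mu> L
        (g :: nat \<Rightarrow> real^'p \<Rightarrow> 'd::euclidean_space \<Rightarrow> real^'p) \<xi> \<sigma> \<alpha> y0 \<psi>.
        stochastic_near_dgd M n E W f \<mu> L g \<xi> \<sigma> \<alpha> y0 \<longrightarrow>
        admissible_psi n \<mu> L \<alpha> \<psi> \<longrightarrow>
        limit_mean_square_error M n W f g \<xi> \<alpha> y0 \<le>
          ennreal (C * (\<alpha>\<^sup>2 * \<sigma>\<^sup>2 / (real n * (1 - c1 n \<mu> L \<alpha> \<psi>)))))"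
proof (intro conjI allI)
  show "\<exists>C>0. \<forall>(M :: 'w measure) n E W (f :: nat \<Rightarrow> real^'p \<Rightarrow> real) \<mu> L
      (g :: nat \<Rightarrow> real^'p \<Rightarrow> 'd::euclidean_space \<Rightarrow> real^'p) \<xi> \<sigma> \<alpha> y0 \<psi>.
      stochastic_near_dgd M n E W f \<mu> L g \<xi> \<sigma> \<alpha> y0 \<longrightarrow>
      uncorrelated_errors M n W f g \<xi> \<alpha> y0 \<longrightarrow>
      admissible_psi n \<mu> L \<alpha> \<psi> \<longrightarrow>
      limit_mean_square_error M n W f g \<xi> \<alpha> y0 \<le>
        ennreal (C * (\<alpha>\<^sup>2 * \<sigma>\<^sup>2 / (real n * (1 - c1 n \<mu> L \<alpha> \<psi>))))"
  proof (intro exI[of _ 1] conjI allI impI)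
    fix M :: "'w measure" and n E W and f :: "nat \<Rightarrow> real^'p \<Rightarrow> real" and \<mu> L
      and g :: "nat \<Rightarrow> real^'p \<Rightarrow> 'd \<Rightarrow> real^'p" and \<xi> \<sigma> \<alpha> y0 \<psi>
    assume dgd: "stochastic_near_dgd M n E W f \<mu> L g \<xi> \<sigma> \<alpha> y0"
      and uncorrelated: "uncorrelated_errors M n W f g \<xi> \<alpha> y0"
      and psi: "admissible_psi n \<mu> L \<alpha> \<psi>"
    show "limit_mean_square_error M n W f g \<xi> \<alpha> y0 \<le>
        ennreal (1 * (\<alpha>\<^sup>2 * \<sigma>\<^sup>2 / (real n * (1 - c1 n \<mu> L \<alpha> \<psi>))))"
      using stochastic_near_dgd.limit_mean_square_error_le[OF dgd psi
          stochastic_near_dgd.mean_error_variance_uncorrelated[OF dgd uncorrelated]]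
      by simp
  qed simp
next
  fix n
  show "\<exists>C>0. \<forall>(M :: 'w measure) E W (f :: nat \<Rightarrow> real^'p \<Rightarrow> real) \<mu> L
      (g :: nat \<Rightarrow> real^'p \<Rightarrow> 'd::euclidean_space \<Rightarrow> real^'p) \<xi> \<sigma> \<alpha> y0 \<psi>.
      stochastic_near_dgd M n E W f \<mu> L g \<xi> \<sigma> \<alpha> y0 \<longrightarrow>
      admissible_psi n \<mu> L \<alpha> \<psi> \<longrightarrow>
      limit_mean_square_error M n W f g \<xi> \<alpha> y0 \<le>
        ennreal (C * (\<alpha>\<^sup>2 * \<sigma>\<^sup>2 / (real n * (1 - c1 n \<mu> L \<alpha> \<psi>))))"
  \<comment> \<open>The factor \<open>real n\<close> undoes the division by \<open>n\<close>. The
    maximum keeps the constant positive for \<open>n = 0\<close>, where the premise is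
    false.\<close>
  proof (intro exI[of _ "max 1 (real n)"] conjI allI impI)
    fix M :: "'w measure" and E W and f :: "nat \<Rightarrow> real^'p \<Rightarrow> real" and \<mu> L
      and g :: "nat \<Rightarrow> real^'p \<Rightarrow> 'd \<Rightarrow> real^'p" and \<xi> \<sigma> \<alpha> y0 \<psi>
    assume dgd: "stochastic_near_dgd M n E W f \<mu> L g \<xi> \<sigma> \<alpha> y0"
      and psi: "admissible_psi n \<mu> L \<alpha> \<psi>"
    have "n \<ge> 1" using dgd by (rule stochastic_near_dgd.agents)
    then have "max 1 (real n) * (\<alpha>\<^sup>2 * \<sigma>\<^sup>2 / (real n * (1 - c1 n \<mu> L \<alpha> \<psi>))) =
        \<alpha>\<^sup>2 * \<sigma>\<^sup>2 / (1 - c1 n \<mu> L \<alpha> \<psi>)"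
      by simp
    then show "limit_mean_square_error M n W f g \<xi> \<alpha> y0 \<le>
        ennreal (max 1 (real n) * (\<alpha>\<^sup>2 * \<sigma>\<^sup>2 / (real n * (1 - c1 n \<mu> L \<alpha> \<psi>))))"
      using stochastic_near_dgd.limit_mean_square_error_le[OF dgd psi
          stochastic_near_dgd.mean_error_variance[OF dgd]]
      by simp
  qed simp
qed

end
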